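(* Let $q,c\in\mathbb{C}$ with $0<|q|<1$, let $k\ge 1$ be an integer, and let $g$ be a non-constant meromorphic function on $\mathbb{C}$ of zero order. Then $$m\left(r,\frac{\mathcal{D}_{q,c}g(z)}{g(z)}\right)=o(T(r,g)),\qquad m\left(r,\frac{\mathcal{D}_{q,c}^{k}g(z)}{g(z)}\right)=o(T(r,g))$$ hold as $r\to\infty$ on a set of logarithmic density $1$.
   Context: For $q\in\mathbb{C}\setminus\{0,1\}$, $c\in\mathbb{C}$ and $g$ meromorphic on $\mathbb{C}$, the Hahn difference operator is $\mathcal{D}_{q,c}g(z)=\frac{g(qz+c)-g(z)}{(q-1)z+c}$, with iterates $\mathcal{D}_{q,c}^{0}g=g$ and $\mathcal{D}_{q,c}^{k}g=\mathcal{D}_{q,c}(\mathcal{D}_{q,c}^{k-1}g)$ for $k\ge1$. $m(r,\cdot)$ and $T(r,\cdot)$ are the Nevanlinna proximity and characteristic functions. The order of $g$ is $\rho(g)=\limsup_{r\to\infty}\frac{\log^{+}T(r,g)}{\log r}$. A set $E\subset[1,\infty)$ has logarithmic density $1$ if $\lim_{r\to\infty}\frac{1}{\log r}\int_{E\cap[1,r]}\frac{dt}{t}=1$. *)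

theory Defs
  imports "HOL-Complex_Analysis.Complex_Analysis"
begin

text \<open>
  A meromorphic function is represented by a total function that is meromorphic on the whole
  plane in the sense of the library. Its values at poles, or at isolated points where it fails to be
  continuous, are arbitrary; none of the notions below depends on them, since integrals over
  circles do not see finitely many points and poles and their orders are defined by punctured limits.
\<close>

definition log_plus :: "real \<Rightarrow> real" where
  "log_plus x = ln (max 1 x)"

definition proximity :: "real \<Rightarrow> (complex \<Rightarrow> complex) \<Rightarrow> real" where
  "proximity r f =
     1 / (2 * pi) * integral {0..2 * pi} (\<lambda>\<theta>. log_plus (norm (f (of_real r * cis \<theta>))))"

text \<open>Poles in the closed disc of radius \<open>t\<close>, counted with multiplicity.\<close>

definition pole_count :: "real \<Rightarrow> (complex \<Rightarrow> complex) \<Rightarrow> real" where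
  "pole_count t f = (\<Sum>z | norm z \<le> t \<and> is_pole f z. real_of_int (- zorder f z))"

definition pole_counting :: "real \<Rightarrow> (complex \<Rightarrow> complex) \<Rightarrow> real" where
  "pole_counting r f =
     integral {0..r} (\<lambda>t. (pole_count t f - pole_count 0 f) / t) + pole_count 0 f * ln r"

definition characteristic :: "real \<Rightarrow> (complex \<Rightarrow> complex) \<Rightarrow> real" where
  "characteristic r f = proximity r f + pole_counting r f"

definition growth_order :: "(complex \<Rightarrow> complex) \<Rightarrow> ereal" where
  "growth_order f = Limsup at_top (\<lambda>r::real. ereal (log_plus (characteristic r f) / ln r))"

text \<open>
  The quotient is taken pointwise. It agrees with the meromorphic function it denotes
  except possibly at isolated points, such as the fixed point of \<open>z \<mapsto> q * z + c\<close>, where the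
  denominator vanishes.
\<close>

definition hahn_diff ::
    "complex \<Rightarrow> complex \<Rightarrow> (complex \<Rightarrow> complex) \<Rightarrow> complex \<Rightarrow> complex" where
  "hahn_diff q c g z = (g (q * z + c) - g z) / ((q - 1) * z + c)"

definition has_log_density_one :: "real set \<Rightarrow> bool" where
  "has_log_density_one E \<longleftrightarrow>
     E \<subseteq> {1..} \<and> E \<in> sets lebesgue \<and>
     ((\<lambda>r. 1 / ln r * integral (E \<inter> {1..r}) (\<lambda>t. 1 / t)) \<longlongrightarrow> 1) at_top"

end

(*
  Near a circle |z| = R without zeros or poles, g is exp H times a finite product of Blaschke
  factors, so that Re H = ln |g| on that circle. The Schwarz formula for H controls
  |H(z) - H(w)| for |z|, |w| <= r by 8r/R times the mean of |ln |g||, hence by O(r/R) T(R, g). The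
  Blaschke factors contribute at most n(R) times ln (R/r) + O(1) to the proximity function of
  g(q^j z + c_j)/g(z), and n(R) ln (R'/R) <= 2 T(R', g) + O(1) for R' > R. With R about e^n r and
  R' about e^(n^2) R, the total is O(1/n) T(R', g).

  Since g has order zero, T(e^(j+s), g) <= 2 T(e^j, g) holds for each fixed s outside a set of j of
  density zero, and a diagonal argument yields one exceptional set for all s. Finally the k-th
  Hahn difference of g is a combination of the functions g(q^j z + c_j), j <= k, with coefficients
  that are bounded near infinity. Only radii avoiding the countably many circles through zeros and
  poles (and their preimages) are used, so all integrands are continuous.
*)
theory Submission imports Defs "HOL-Real_Asymp.Real_Asymp" begin

section \<open>Means over circles\<close>

text \<open>On a circle passing close to zeros or poles the quotient g(q^j z + c_j)/g(z) has no
  useful pointwise bound. The singular terms ln |z - p| are tamed only by averaging, since their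
  circle means are explicit. Two outer radii are needed because the factorization on |z| < R brings
  in the unweighted count n(R), and T controls it only after division by ln (R'/R). The loss per
  point, about ln (R/r), is of order n, so ln (R'/R) must be of larger order; n^2 is a convenient
  choice. The comparison of T(R', g) with T(r, g) is made on the scale ln r, where a unit step has
  logarithmic measure 1, so that natural density of indices becomes logarithmic density of radii. As
  |q| < 1, every large disc is mapped into itself by z -> q z + c, and one bound for H on |z| <= r
  serves all shifts. Summing k + 1 terms leaves an additive ln (k + 1). Absorbing it into o(T)
  requires T to be unbounded; this is where non-constancy enters, through an argument of Liouville
  type.\<close>

definition circle_mean :: "real \<Rightarrow> (complex \<Rightarrow> 'a::banach) \<Rightarrow> 'a" where
  "circle_mean r f = (1 / (2 * pi)) *\<^sub>R integral {0..2 * pi} (\<lambda>t. f (of_real r * cis t))"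

lemma circle_integrable:
  fixes f :: "complex \<Rightarrow> 'a::banach"
  assumes "continuous_on (sphere 0 r) f" "r \<ge> 0"
  shows "(\<lambda>t. f (of_real r * cis t)) integrable_on {0..2*pi}"
  by (rule integrable_continuous_real, rule continuous_on_compose2[OF assms(1)])
     (use assms in \<open>auto intro!: continuous_intros simp: norm_mult\<close>)

lemma circle_mean_const [simp]: "circle_mean r (\<lambda>_. c) = c"
  by (simp add: circle_mean_def)

lemma circle_mean_cong:
  assumes "\<And>z. norm z = r \<Longrightarrow> f z = h z" "r \<ge> 0"
  shows "circle_mean r f = circle_mean r h"
  unfolding circle_mean_def by (simp add: assms norm_mult)

lemma circle_mean_add:
  fixes f h :: "complex \<Rightarrow> 'a::banach"
  assumes "continuous_on (sphere 0 r) f" "continuous_on (sphere 0 r) h" "r \<ge> 0"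
  shows "circle_mean r (\<lambda>z. f z + h z) = circle_mean r f + circle_mean r h"
  unfolding circle_mean_def
  by (simp add: Henstock_Kurzweil_Integration.integral_add circle_integrable assms scaleR_add_right)

lemma circle_mean_diff:
  fixes f h :: "complex \<Rightarrow> 'a::banach"
  assumes "continuous_on (sphere 0 r) f" "continuous_on (sphere 0 r) h" "r \<ge> 0"
  shows "circle_mean r (\<lambda>z. f z - h z) = circle_mean r f - circle_mean r h"
  unfolding circle_mean_def
  by (simp add: Henstock_Kurzweil_Integration.integral_diff circle_integrable assms scaleR_diff_right)

lemma circle_mean_cmult:
  fixes f :: "complex \<Rightarrow> 'a::{banach,real_normed_field}"
  shows "circle_mean r (\<lambda>z. c * f z) = c * circle_mean r f"
  unfolding circle_mean_def by (simp add: scaleR_conv_of_real)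

lemma circle_mean_sum:
  fixes f :: "'i \<Rightarrow> complex \<Rightarrow> 'a::banach"
  assumes "\<And>i. i \<in> I \<Longrightarrow> continuous_on (sphere 0 r) (f i)" "r \<ge> 0"
  shows "circle_mean r (\<lambda>z. \<Sum>i\<in>I. f i z) = (\<Sum>i\<in>I. circle_mean r (f i))"
  using assms(1)
proof (induction I rule: infinite_finite_induct)
  case (insert x F)
  then show ?case
    by (simp add: circle_mean_add continuous_on_sum assms(2))
qed auto

lemma circle_mean_mono:
  fixes f h :: "complex \<Rightarrow> real"
  assumes "continuous_on (sphere 0 r) f" "continuous_on (sphere 0 r) h" "r \<ge> 0"
    and "\<And>z. norm z = r \<Longrightarrow> f z \<le> h z"
  shows "circle_mean r f \<le> circle_mean r h"
  unfolding circle_mean_def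
  using integral_le[OF circle_integrable[OF assms(1,3)] circle_integrable[OF assms(2,3)]] assms(3,4)
  by (simp add: norm_mult divide_right_mono)

text \<open>Covers arbitrary functions, since \<open>integral\<close> returns 0 on a non-integrable
  integrand; this makes \<open>proximity\<close> nonnegative at every nonnegative radius.\<close>

lemma circle_mean_nonneg:
  fixes f :: "complex \<Rightarrow> real"
  assumes "r \<ge> 0" "\<And>z. norm z = r \<Longrightarrow> 0 \<le> f z"
  shows "0 \<le> circle_mean r f"
proof (cases "(\<lambda>t. f (of_real r * cis t)) integrable_on {0..2*pi}")
  case True
  then show ?thesis
    unfolding circle_mean_def using assms
    by (auto intro!: divide_nonneg_nonneg Henstock_Kurzweil_Integration.integral_nonneg simp: norm_mult)
qed (simp add: circle_mean_def not_integrable_integral)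

lemma circle_mean_norm_le:
  fixes f :: "complex \<Rightarrow> 'a::{banach,euclidean_space}"
  assumes "continuous_on (sphere 0 r) f" "r \<ge> 0"
  shows "norm (circle_mean r f) \<le> circle_mean r (\<lambda>z. norm (f z))"
proof -
  have "continuous_on (sphere 0 r) (\<lambda>z. norm (f z))"
    using assms(1) by (rule continuous_on_norm)
  then have "norm (integral {0..2*pi} (\<lambda>t. f (of_real r * cis t)))
      \<le> integral {0..2*pi} (\<lambda>t. norm (f (of_real r * cis t)))"
    by (intro Henstock_Kurzweil_Integration.integral_norm_bound_integral circle_integrable assms
         circle_integrable[of r "\<lambda>z. norm (f z)"]) auto
  then show ?thesis
    unfolding circle_mean_def by (simp add: divide_right_mono)
qed

lemma circle_mean_bounded_linear:
  assumes "bounded_linear T" "continuous_on (sphere 0 r) f" "r \<ge> 0"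
  shows "circle_mean r (\<lambda>z. T (f z)) = T (circle_mean r f)"
  unfolding circle_mean_def
  using integral_linear[OF circle_integrable[OF assms(2,3)] assms(1)]
  by (simp add: o_def linear_simps assms(1))

section \<open>Cauchy and Schwarz formulas as circle means\<close>

lemma circle_mean_Cauchy:
  assumes f: "f holomorphic_on cball 0 r" and z: "norm z < r"
  shows "circle_mean r (\<lambda>w. f w * w / (w - z)) = f z"
proof -
  have "((\<lambda>u. f u / (u - z)) has_contour_integral (2 * of_real pi * \<i> * f z)) (circlepath 0 r)"
    using Cauchy_integral_circlepath_simple[OF f, of z] z by simp
  then have "((\<lambda>t. f (0 + r * cis t) / (0 + r * cis t - z) * r * \<i> * cis t)
      has_integral (2 * of_real pi * \<i> * f z)) {0..2*pi}"
    unfolding circlepath_def by (subst (asm) has_contour_integral_part_circlepath_iff) auto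
  \<comment> \<open>On the circle dw = i w dt, which accounts for the factor w in the mean;
    multiplying by -i turns 2 pi i into 2 pi.\<close>
  then have "((\<lambda>t. (-\<i>) * (f (0 + r * cis t) / (0 + r * cis t - z) * r * \<i> * cis t))
      has_integral (-\<i>) * (2 * of_real pi * \<i> * f z)) {0..2*pi}"
    by (rule has_integral_mult_right)
  then have "((\<lambda>t. f (r * cis t) * (r * cis t) / (r * cis t - z))
      has_integral (2 * of_real pi * f z)) {0..2*pi}"
    by (simp add: mult_ac)
  then show ?thesis
    unfolding circle_mean_def by (simp add: integral_unique scaleR_conv_of_real)
qed

lemma circle_mean_holomorphic:
  assumes "f holomorphic_on cball 0 r" "r > 0"
  shows "circle_mean r f = f 0"
proof -
  have "circle_mean r f = circle_mean r (\<lambda>w. f w * w / (w - 0))"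
    using assms by (intro circle_mean_cong) auto
  then show ?thesis
    using circle_mean_Cauchy[OF assms(1), of 0] assms by simp
qed

text \<open>The kernel (w + z)/(w - z) equals 2 w/(w - z) - 1, so Cauchy's formula gives 2 f(z) -
  f(0) as the mean of f times the kernel. The mean of cnj f times the kernel is cnj (f 0), because
  on the circle this product is the conjugate of a function holomorphic in the closed disc. Half the
  sum is the claim.\<close>

lemma circle_mean_Schwarz:
  assumes f: "f holomorphic_on cball 0 r" and z: "norm z < r"
  shows "circle_mean r (\<lambda>w. of_real (Re (f w)) * ((w + z) / (w - z))) = f z - \<i> * of_real (Im (f 0))"
proof -
  have r: "r > 0" using z norm_ge_zero[of z] by linarith
  have ne: "w \<noteq> z" if "norm w = r" for w using that z by auto
  have cf: "continuous_on (sphere 0 r) f"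
    using f by (intro continuous_on_subset[OF holomorphic_on_imp_continuous_on[OF f]]) auto
  have ne2: "of_real (r^2) - cnj z * w \<noteq> 0" if "norm w \<le> r" for w
  proof
    assume "of_real (r^2) - cnj z * w = 0"
    then have "norm (cnj z * w) = r^2" by (metis eq_iff_diff_eq_0 norm_of_real abs_power2 power2_abs)
    moreover have "norm (cnj z * w) \<le> norm z * r" using that by (simp add: norm_mult mult_left_mono)
    moreover have "norm z * r < r^2" using z r by (simp add: power2_eq_square)
    ultimately show False by simp
  qed
  \<comment> \<open>On |w| = r one has r^2 = w cnj w, so the conjugate of \<open>h\<close> is cnj f
    times the kernel there. The pole r^2 / cnj z of the fraction lies outside the closed
    disc.\<close>
  define h where "h = (\<lambda>w. f w * ((of_real (r^2) + cnj z * w) / (of_real (r^2) - cnj z * w)))"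
  have hh: "h holomorphic_on cball 0 r"
    unfolding h_def using ne2 by (intro holomorphic_intros f) auto
  have 1: "circle_mean r h = f 0"
    using circle_mean_holomorphic[OF hh r] r by (simp add: h_def)
  have ch: "continuous_on (sphere 0 r) h"
    by (intro continuous_on_subset[OF holomorphic_on_imp_continuous_on[OF hh]]) auto
  have 2: "circle_mean r (\<lambda>w. cnj (h w)) = cnj (f 0)"
    using circle_mean_bounded_linear[OF bounded_linear_cnj ch] 1 r by simp
  have 3: "cnj (h w) = cnj (f w) * ((w + z) / (w - z))" if "norm w = r" for w
  proof -
    have rr: "of_real (r^2) = w * cnj w" using that complex_norm_square[of w] by simp
    have "w \<noteq> 0" using that r by auto
    then have "(of_real (r^2) + z * cnj w) / (of_real (r^2) - z * cnj w) = ((w + z) * cnj w) / ((w - z) * cnj w)"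
      unfolding rr by (simp add: algebra_simps)
    also have "\<dots> = (w + z) / (w - z)" using \<open>w \<noteq> 0\<close> by simp
    finally show ?thesis
      by (simp only: h_def complex_cnj_mult complex_cnj_divide complex_cnj_add complex_cnj_diff
          complex_cnj_complex_of_real complex_cnj_cnj)
  qed
  have 4: "circle_mean r (\<lambda>w. f w * ((w + z) / (w - z))) = 2 * f z - f 0"
  proof -
    have "circle_mean r (\<lambda>w. f w * ((w + z) / (w - z))) = circle_mean r (\<lambda>w. 2 * (f w * w / (w - z)) - f w)"
      using r ne by (intro circle_mean_cong) (auto simp: field_simps)
    also have "\<dots> = 2 * circle_mean r (\<lambda>w. f w * w / (w - z)) - circle_mean r f"
      using r ne by (subst circle_mean_diff) (auto intro!: continuous_intros cf simp: circle_mean_cmult simp del: times_divide_eq_right)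
    finally show ?thesis using circle_mean_Cauchy[OF f z] circle_mean_holomorphic[OF f r] by simp
  qed
  have "circle_mean r (\<lambda>w. of_real (Re (f w)) * ((w + z) / (w - z))) =
      circle_mean r (\<lambda>w. (1/2) * (f w * ((w + z) / (w - z)) + cnj (h w)))"
  proof (intro circle_mean_cong)
    fix w :: complex assume w: "norm w = r"
    have "of_real (Re (f w)) = (1/2) * (f w + cnj (f w))" by (simp add: complex_add_cnj)
    then show "of_real (Re (f w)) * ((w + z) / (w - z)) = (1/2) * (f w * ((w + z) / (w - z)) + cnj (h w))"
      by (simp only: 3[OF w] distrib_left distrib_right mult.assoc)
  qed (use r in auto)
  also have "\<dots> = (1/2) * (2 * f z - f 0 + cnj (f 0))"
    unfolding circle_mean_cmult using r ne 2 4
    by (subst circle_mean_add) (auto intro!: continuous_intros cf ch)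
  also have "\<dots> = f z - \<i> * of_real (Im (f 0))"
    by (simp add: complex_eq_iff)
  finally show ?thesis .
qed

section \<open>Circle means of ln |z - a|\<close>

lemma circle_mean_Re_holomorphic:
  assumes "f holomorphic_on cball 0 r" "r > 0"
  shows "circle_mean r (\<lambda>z. Re (f z)) = Re (f 0)"
  using circle_mean_bounded_linear[OF bounded_linear_Re, of r f] circle_mean_holomorphic[OF assms]
    continuous_on_subset[OF holomorphic_on_imp_continuous_on[OF assms(1)], of "sphere 0 r"] assms
  by (auto simp: subset_iff)

text \<open>On the disc |z| < |a| the function z - a has a holomorphic logarithm, and ln |z - a| is
  its real part, so the mean value property applies.\<close>

lemma circle_mean_ln_norm_outside:
  assumes "r < norm a" "r > 0"
  shows "circle_mean r (\<lambda>z. ln (norm (z - a))) = ln (norm a)"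
proof -
  have nz: "z - a \<noteq> 0" if "z \<in> ball 0 (norm a)" for z using that by auto
  have "(\<lambda>z. z - a) holomorphic_on ball 0 (norm a)" by (intro holomorphic_intros)
  moreover have "0 \<in> ball 0 (norm a)" using assms by auto
  ultimately obtain L where L: "L holomorphic_on ball 0 (norm a)"
      "\<And>z. z \<in> ball 0 (norm a) \<Longrightarrow> exp (L z) = z - a"
    using holomorphic_logarithm_exists[OF convex_ball open_ball] nz by metis
  have e: "ln (norm (z - a)) = Re (L z)" if "z \<in> ball 0 (norm a)" for z
    using L(2)[OF that] norm_exp_eq_Re[of "L z"] by simp
  have "circle_mean r (\<lambda>z. ln (norm (z - a))) = circle_mean r (\<lambda>z. Re (L z))"
    using assms by (intro circle_mean_cong e) auto
  also have "\<dots> = Re (L 0)"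
    using assms by (intro circle_mean_Re_holomorphic holomorphic_on_subset[OF L(1)]) auto
  also have "\<dots> = ln (norm a)" using e[of 0] assms by force
  finally show ?thesis .
qed

text \<open>Jensen's formula for a single linear factor. A point inside the circle is exchanged for
  its mirror image, which lies outside.\<close>

lemma circle_mean_ln_norm:
  assumes "norm a \<noteq> r" "r > 0"
  shows "circle_mean r (\<lambda>z. ln (norm (z - a))) = ln (max r (norm a))"
proof (cases "norm a < r")
  case False
  then show ?thesis using circle_mean_ln_norm_outside[of r a] assms by (simp add: max_def)
next
  case True
  show ?thesis
  proof (cases "a = 0")
    case True
    have "circle_mean r (\<lambda>z. ln (norm (z - a))) = circle_mean r (\<lambda>z. ln r)"
      using assms True by (intro circle_mean_cong) auto
    then show ?thesis using True assms by simp
  next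
    case a0: False
    \<comment> \<open>Inversion of \<open>a\<close> in the circle: the ratio of |z - a| to |z - b|
      is constantly |a|/r on it.\<close>
    define b where "b = of_real (r^2) / cnj a"
    have nb: "norm b = r^2 / norm a" by (simp add: b_def norm_divide norm_power)
    have rb: "r < norm b" using True a0 assms by (simp add: nb field_simps power2_eq_square)
    have b0: "b \<noteq> 0" using rb assms by auto
    have e: "ln (norm (z - a)) = ln (norm (z - b)) + ln (norm a / r)" if z: "norm z = r" for z
    proof -
      have "z \<noteq> 0" using z assms by auto
      have rr: "of_real (r^2) = z * cnj z" using z complex_norm_square[of z] by simp
      have "(z - b) * cnj a = - z * cnj (z - a)" using a0 by (simp add: b_def rr algebra_simps flip: of_real_power)
      then have "norm (z - b) * norm a = r * norm (z - a)"
        by (metis complex_mod_cnj norm_minus_cancel norm_mult z)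
      then have "norm (z - a) = norm (z - b) * (norm a / r)" using assms by (simp add: field_simps)
      moreover have "norm (z - b) > 0" "norm a / r > 0" using z rb a0 assms by auto
      ultimately show ?thesis by (simp only: ln_mult_pos)
    qed
    have "circle_mean r (\<lambda>z. ln (norm (z - a))) = circle_mean r (\<lambda>z. ln (norm (z - b)) + ln (norm a / r))"
      using assms by (intro circle_mean_cong e) auto
    also have "\<dots> = ln (norm b) + ln (norm a / r)"
      using assms rb by (subst circle_mean_add)
        (auto intro!: continuous_intros simp: circle_mean_ln_norm_outside)
    also have "\<dots> = ln (norm b * (norm a / r))" using assms a0 b0 by (subst ln_mult_pos) auto
    also have "norm b * (norm a / r) = r" using a0 assms by (simp add: nb power2_eq_square)
    finally show ?thesis using True by simp
  qed
qed

section \<open>Local factorization\<close>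

definition blaschke :: "real \<Rightarrow> complex \<Rightarrow> complex \<Rightarrow> complex" where
  "blaschke R p z = of_real R * (z - p) / (of_real (R^2) - cnj p * z)"

lemma blaschke_denom:
  assumes "norm p * norm z < R^2"
  shows "of_real (R^2) - cnj p * z \<noteq> 0"
proof
  assume "of_real (R^2) - cnj p * z = 0"
  then have "norm (cnj p * z) = norm (of_real (R^2) :: complex)" by simp
  then show False using assms by (simp add: norm_mult norm_power)
qed

lemma mult_less_square:
  assumes "norm p < R" "norm z \<le> (R::real)"
  shows "norm p * norm z < R^2"
proof -
  have "R > 0" using assms norm_ge_zero[of p] by linarith
  moreover have "norm p * norm z \<le> norm p * R" using assms by (intro mult_left_mono) auto
  moreover have "norm p * R < R * R" using assms \<open>R > 0\<close> by (intro mult_strict_right_mono)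
  ultimately show ?thesis unfolding power2_eq_square by linarith
qed

lemma norm_blaschke_circle:
  assumes "norm p < R" "norm z = R"
  shows "norm (blaschke R p z) = 1"
proof -
  have R: "R > 0" using assms(1) norm_ge_zero[of p] by linarith
  have "of_real (R^2) = z * cnj z" using assms complex_norm_square[of z] by simp
  then have "of_real (R^2) - cnj p * z = z * cnj (z - p)" by (simp add: algebra_simps)
  then have "norm (of_real (R^2) - cnj p * z) = R * norm (z - p)"
    using assms by (metis norm_mult complex_mod_cnj)
  moreover have "z \<noteq> p" using assms by auto
  ultimately show ?thesis using R by (simp add: blaschke_def norm_mult norm_divide del: of_real_power)
qed

text \<open>The squared moduli of denominator and numerator differ by (R^2 - |z|^2) (R^2 - |p|^2),
  which is nonnegative on the disc.\<close>

lemma norm_blaschke_le_1: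
  assumes "norm p < R" "norm z \<le> R"
  shows "norm (blaschke R p z) \<le> 1"
proof -
  have R: "R > 0" using assms(1) norm_ge_zero[of p] by linarith
  let ?d = "of_real (R^2) - cnj p * z"
  have "norm ?d ^ 2 - norm (of_real R * (z - p)) ^ 2 = (R^2 - norm z ^ 2) * (R^2 - norm p ^ 2)"
    by (simp only: cmod_power2) (simp add: algebra_simps power2_eq_square)
  moreover have "0 \<le> (R^2 - norm z ^ 2) * (R^2 - norm p ^ 2)"
    using assms by (intro mult_nonneg_nonneg) (auto intro!: power_mono)
  ultimately have "norm (of_real R * (z - p)) ^ 2 \<le> norm ?d ^ 2" by linarith
  then have "norm (of_real R * (z - p)) \<le> norm ?d" by (rule power2_le_imp_le) simp
  moreover have "norm ?d > 0" using blaschke_denom mult_less_square[OF assms] by simp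
  ultimately show ?thesis by (simp add: blaschke_def norm_divide)
qed

lemma blaschke_eq_0_iff:
  assumes "norm p < R" "norm p * norm z < R^2"
  shows "blaschke R p z = 0 \<longleftrightarrow> z = p"
  using blaschke_denom[OF assms(2)] assms(1) norm_ge_zero[of p]
  by (auto simp: blaschke_def simp del: of_real_power)

lemma blaschke_analytic:
  assumes "norm p * norm z < R^2"
  shows "blaschke R p analytic_on {z}"
  unfolding blaschke_def using blaschke_denom[OF assms]
  by (intro analytic_intros) auto

lemma zorder_blaschke:
  assumes "norm p < R"
  shows "zorder (blaschke R p) p = 1"
proof (rule zorder_eqI[where g = "\<lambda>z. of_real R / (of_real (R^2) - cnj p * z)" and S = "ball 0 R"])
  have R: "R > 0" using assms norm_ge_zero[of p] by linarith
  have d: "of_real (R^2) - cnj p * z \<noteq> 0" if "z \<in> ball 0 R" for z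
    using blaschke_denom mult_less_square[OF assms, of z] that by auto
  show "(\<lambda>z. of_real R / (of_real (R^2) - cnj p * z)) holomorphic_on ball 0 R"
    using d by (intro holomorphic_intros) auto
  show "of_real R / (of_real (R^2) - cnj p * p) \<noteq> 0"
    using d[of p] assms R by simp
  fix w show "blaschke R p w = of_real R / (of_real (R^2) - cnj p * w) * (w - p) powi 1"
    by (simp add: blaschke_def)
qed (use assms in auto)

text \<open>Besides zeros and poles this contains the isolated points at which the total function
  has an arbitrary value. As \<open>zorder\<close> sees only punctured neighbourhoods, such a point
  carries its true order, and order 0 makes its Blaschke power trivial.\<close>

definition bad :: "(complex \<Rightarrow> complex) \<Rightarrow> complex set" where
  "bad g = {z. \<not> (g analytic_on {z} \<and> g z \<noteq> 0)}"

definition good_radius :: "(complex \<Rightarrow> complex) \<Rightarrow> real \<Rightarrow> bool" where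
  "good_radius g R \<longleftrightarrow> 0 < R \<and> (\<forall>z. norm z = R \<longrightarrow> z \<notin> bad g)"

text \<open>Vanishing off a sparse set is the form of vanishing identically that ignores arbitrary
  values at isolated points. Its negation makes the zeros and poles sparse and \<open>zorder\<close>
  meaningful everywhere.\<close>

locale nonzero_meromorphic =
  fixes g :: "complex \<Rightarrow> complex"
  assumes mero: "g meromorphic_on UNIV"
    and nonzero: "\<not> (\<forall>\<^sub>\<approx>z\<in>UNIV. g z = 0)"
begin

lemma bad_sparse: "bad g sparse_in UNIV"
proof -
  have "\<forall>\<^sub>\<approx>z\<in>UNIV. g z \<noteq> 0"
    using meromorphic_imp_constant_or_avoid[OF mero open_UNIV connected_UNIV, of 0] nonzero by auto
  with meromorphic_on_imp_analytic_cosparse[OF mero]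
  have "\<forall>\<^sub>\<approx>z\<in>UNIV. g analytic_on {z} \<and> g z \<noteq> 0"
    by eventually_elim auto
  then show ?thesis by (simp add: eventually_cosparse bad_def)
qed

lemma eventually_not_bad: "eventually (\<lambda>w. w \<notin> bad g) (at z)"
  using bad_sparse by (metis UNIV_I eventually_cosparse_imp_eventually_at eventually_not_in_cosparse)

lemma finite_bad: "compact K \<Longrightarrow> finite (K \<inter> bad g)"
  using bad_sparse by (metis sparse_in_compact_finite sparse_in_subset subset_UNIV)

lemma finite_bad_ball [simp]: "finite (bad g \<inter> ball 0 R)"
  by (rule finite_subset[OF _ finite_bad[of "cball 0 R"]]) auto

lemma countable_bad: "countable (bad g)"
  using sparse_imp_countable[OF open_UNIV bad_sparse] by simp

lemma frequently_nonzero: "\<exists>\<^sub>F w in at z. g w \<noteq> 0"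
  using eventually_not_bad[of z] by (auto simp: bad_def intro!: eventually_frequently elim: eventually_mono)

lemma mero_at: "g meromorphic_on {z}"
  using mero by (rule meromorphic_on_subset) auto

lemma not_bad_zorder: "z \<notin> bad g \<Longrightarrow> zorder g z = 0"
  by (auto simp: bad_def intro: zorder_eq_0I)

lemma pole_iff: "is_pole g z \<longleftrightarrow> zorder g z < 0"
  using mero_at[of z] frequently_nonzero[of z]
  by (auto simp: meromorphic_at_iff intro: isolated_pole_imp_neg_zorder neg_zorder_imp_is_pole)

text \<open>Multiplying by Blaschke factors to the powers -zorder cancels all zeros and poles in the
  disc; the product extends to a zero-free holomorphic function, which has a logarithm. The argument
  runs on a slightly larger disc so that \<open>H\<close> is holomorphic up to the circle |z| =
  R.\<close>

lemma Schwarz_factorization: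
  assumes good: "good_radius g R"
  obtains H where "H holomorphic_on cball 0 R"
    "\<And>z. \<lbrakk>norm z \<le> R; z \<notin> bad g\<rbrakk> \<Longrightarrow>
       g z = exp (H z) * (\<Prod>p\<in>bad g \<inter> ball 0 R. blaschke R p z powi zorder g p)"
proof -
  let ?P = "bad g \<inter> ball 0 R"
  have R: "R > 0" using good by (simp add: good_radius_def)
  \<comment> \<open>For x slightly above R the poles R^2 / cnj p of the Blaschke factors still have
    modulus above x.\<close>
  have "\<forall>\<^sub>F x in at_right R. \<forall>p\<in>?P. norm p * x < R^2"
  proof (intro eventually_ball_finite ballI)
    fix p assume "p \<in> ?P"
    then have "norm p * R < R^2" using mult_less_square[of p R R] R by auto
    moreover have "((\<lambda>x. norm p * x) \<longlongrightarrow> norm p * R) (at_right R)"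
      by (intro tendsto_intros)
    ultimately show "\<forall>\<^sub>F x in at_right R. norm p * x < R^2" by (rule order_tendstoD(2)[rotated])
  qed simp
  \<comment> \<open>Only finitely many bad points lie in |z| <= R + 1 and none on |z| = R, so a thin
    annulus beyond the circle is free of them.\<close>
  moreover have "\<forall>\<^sub>F x in at_right R. \<forall>p\<in>cball 0 (R+1) \<inter> bad g. \<not> (R \<le> norm p \<and> norm p < x)"
  proof (intro eventually_ball_finite ballI finite_bad compact_cball)
    fix p assume p: "p \<in> cball 0 (R+1) \<inter> bad g"
    then have "norm p \<noteq> R" using good by (auto simp: good_radius_def)
    then show "\<forall>\<^sub>F x in at_right R. \<not> (R \<le> norm p \<and> norm p < x)"
    proof (cases "norm p < R")
      case False
      then have "R < norm p" using \<open>norm p \<noteq> R\<close> by simp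
      then show ?thesis using eventually_at_right_real[of R "norm p"]
        by (auto elim: eventually_mono)
    qed auto
  qed
  moreover have "\<forall>\<^sub>F x in at_right R. x < R + 1 \<and> R < x"
    using eventually_at_right_real[of R "R+1"] by (auto elim: eventually_mono)
  ultimately have "\<forall>\<^sub>F x in at_right R. (\<forall>p\<in>?P. norm p * x < R^2) \<and>
     (\<forall>p\<in>cball 0 (R+1) \<inter> bad g. \<not> (R \<le> norm p \<and> norm p < x)) \<and> x < R + 1 \<and> R < x"
    by eventually_elim blast
  then have "\<exists>x. (\<forall>p\<in>?P. norm p * x < R^2) \<and>
     (\<forall>p\<in>cball 0 (R+1) \<inter> bad g. \<not> (R \<le> norm p \<and> norm p < x)) \<and> x < R + 1 \<and> R < x"
    by (rule eventually_happens'[OF trivial_limit_at_right_real])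
  then obtain R1 where R1: "\<forall>p\<in>?P. norm p * R1 < R^2"
     "\<forall>p\<in>cball 0 (R+1) \<inter> bad g. \<not> (R \<le> norm p \<and> norm p < R1)" "R1 < R + 1" "R < R1"
    by (elim exE conjE)
  have badR1: "p \<in> ?P" if "p \<in> bad g" "norm p < R1" for p
    using bspec[OF R1(2), of p] R1(3) that by auto
  have den: "norm p * norm z < R^2" if "p \<in> ?P" "norm z < R1" for p z
    using bspec[OF R1(1) that(1)] that(2) mult_left_mono[of "norm z" R1 "norm p"] by auto
  define B where "B = (\<lambda>z. \<Prod>p\<in>?P. blaschke R p z powi (- zorder g p))"
  define F where "F = (\<lambda>z. g z * B z)"
  have Ban: "B analytic_on {z}" "B z \<noteq> 0" if "norm z < R1" "z \<notin> ?P" for z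
  proof -
    have nz: "blaschke R p z \<noteq> 0" if "p \<in> ?P" for p
      using blaschke_eq_0_iff[of p R z] den[of p z] that \<open>norm z < R1\<close> \<open>z \<notin> ?P\<close> by auto
    show "B analytic_on {z}"
      unfolding B_def using nz that den
      by (intro analytic_on_prod analytic_on_power_int blaschke_analytic) auto
    show "B z \<noteq> 0" unfolding B_def using nz by simp
  qed
  have Bmero: "blaschke R p meromorphic_on {z}" if "p \<in> ?P" "norm z < R1" for p z
    using that den by (intro analytic_on_imp_meromorphic_on blaschke_analytic) auto
  have evP: "\<forall>\<^sub>F w in at z. norm w < R1 \<and> w \<notin> ?P" if "norm z < R1" for z
  proof -
    have "\<forall>\<^sub>F w in at z. w \<in> ball 0 R1"
      using that by (intro eventually_at_in_open') auto
    with eventually_not_bad[of z] show ?thesis by eventually_elim auto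
  qed
  have Fan: "F analytic_on {z}" "F z \<noteq> 0" if "norm z < R1" "z \<notin> bad g" for z
    using Ban[of z] that unfolding F_def by (auto simp: bad_def intro!: analytic_intros)
  have key: "remove_sings F analytic_on {z} \<and> remove_sings F z \<noteq> 0" if z: "norm z < R1" for z
  proof (cases "z \<in> bad g")
    case False
    then show ?thesis using Fan[OF z] remove_sings_analytic_on[of F "{z}"] by simp
  next
    case True
    then have zP: "z \<in> ?P" using badR1 z by blast
    have mB: "B meromorphic_on {z}" unfolding B_def using Bmero z
      by (intro meromorphic_intros) auto
    have mF: "F meromorphic_on {z}" unfolding F_def by (intro meromorphic_intros mB mero_at)
    have evB: "\<forall>\<^sub>F w in at z. B w \<noteq> 0"
      using evP[OF z] by eventually_elim (use Ban in auto)
    have fF: "\<exists>\<^sub>F w in at z. F w \<noteq> 0"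
    proof (rule eventually_frequently)
      show "\<forall>\<^sub>F w in at z. F w \<noteq> 0"
        using evP[OF z] eventually_not_bad[of z] by eventually_elim (use Fan in blast)
    qed simp
    \<comment> \<open>Only the factor belonging to z itself vanishes at z. Hence \<open>B\<close>
      has order -zorder g z there and \<open>F\<close> has order 0, which makes the singularity
      removable with a nonzero value.\<close>
    have zo: "zorder (\<lambda>w. blaschke R p w powi (- zorder g p)) z = - zorder g p * (if p = z then 1 else 0)"
      if p: "p \<in> ?P" for p
    proof -
      have "\<exists>\<^sub>F w in at z. blaschke R p w \<noteq> 0"
      proof (rule eventually_frequently)
        show "\<forall>\<^sub>F w in at z. blaschke R p w \<noteq> 0"
          using evP[OF z]
        proof eventually_elim
          case (elim w)
          then show ?case using blaschke_eq_0_iff[of p R w] den[OF p, of w] p by auto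
        qed
      qed simp
      then have "zorder (\<lambda>w. blaschke R p w powi (- zorder g p)) z = - zorder g p * zorder (blaschke R p) z"
        using Bmero[OF p z] by (intro zorder_power_int)
      moreover have "zorder (blaschke R p) z = (if p = z then 1 else 0)"
      proof (cases "p = z")
        case True then show ?thesis using zorder_blaschke[of p R] p by simp
      next
        case False
        then have "blaschke R p z \<noteq> 0" using blaschke_eq_0_iff[of p R z] den[OF p z] p by auto
        then show ?thesis using False blaschke_analytic[OF den[OF p z]] by (simp add: zorder_eq_0I)
      qed
      ultimately show ?thesis by simp
    qed
    have "zorder F z = zorder g z + zorder B z"
      unfolding F_def using mB mero_at frequently_nonzero evB
      by (intro zorder_mult) (auto intro: eventually_frequently)
    also have "zorder B z = (\<Sum>p\<in>?P. zorder (\<lambda>w. blaschke R p w powi (- zorder g p)) z)"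
      using evB unfolding B_def
      by (intro zorder_prod meromorphic_on_powi Bmero z) auto
    also have "\<dots> = (\<Sum>p\<in>?P. if p = z then - zorder g z else 0)"
      using zo by (intro sum.cong) auto
    also have "\<dots> = - zorder g z" using zP by simp
    finally have zF: "zorder F z = 0" by simp
    have iso: "isolated_singularity_at F z" "not_essential F z"
      using mF by (auto simp: meromorphic_at_iff)
    have "\<not> is_pole F z" using isolated_pole_imp_neg_zorder[OF iso(1)] zF by auto
    then obtain c where c: "F \<midarrow>z\<rightarrow> c" using iso(2) by (auto simp: not_essential_def)
    have an: "remove_sings F analytic_on {z}" by (rule remove_sings_analytic_at[OF iso(1) c])
    have "\<exists>\<^sub>F w in at z. remove_sings F w \<noteq> 0"
      using frequently_eventually_frequently[OF fF eventually_remove_sings_eq_at[OF iso(1)]]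
      by (rule frequently_elim1) auto
    then show ?thesis using an zF zorder_eq_0_iff[OF an] iso(1) by simp
  qed
  have "remove_sings F analytic_on ball 0 R1"
    using key by (subst analytic_on_analytic_at) auto
  then have "remove_sings F holomorphic_on ball 0 R1" by (rule analytic_imp_holomorphic)
  moreover have "\<And>z. z \<in> ball 0 R1 \<Longrightarrow> remove_sings F z \<noteq> 0" using key by auto
  moreover have "0 \<in> ball 0 R1" using R R1 by auto
  ultimately obtain H where H: "H holomorphic_on ball 0 R1"
      "\<And>z. z \<in> ball 0 R1 \<Longrightarrow> exp (H z) = remove_sings F z"
    using holomorphic_logarithm_exists[OF convex_ball open_ball] by metis
  show thesis
  proof (rule that[of H])
    show "H holomorphic_on cball 0 R"
      using R1 by (intro holomorphic_on_subset[OF H(1)]) auto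
    fix z assume z: "norm z \<le> R" "z \<notin> bad g"
    then have z1: "norm z < R1" using R1 by auto
    have "exp (H z) = g z * B z" using H(2)[of z] z1 Fan(1)[OF z1 z(2)] by (simp add: F_def)
    moreover have "B z * (\<Prod>p\<in>?P. blaschke R p z powi zorder g p) = 1"
    proof -
      have "blaschke R p z \<noteq> 0" if "p \<in> ?P" for p
        using blaschke_eq_0_iff[of p R z] den[of p z] that z z1 by auto
      then show ?thesis unfolding B_def prod.distrib[symmetric]
        by (intro prod.neutral) (auto simp: power_int_minus)
    qed
    ultimately show "g z = exp (H z) * (\<Prod>p\<in>?P. blaschke R p z powi zorder g p)"
      by (simp add: mult.assoc)
  qed
qed

end

section \<open>Nevanlinna functions on circles free of zeros and poles\<close>

text \<open>Serves the Blaschke denominators R^2 - cnj p z, where p = 0 makes the slope vanish, as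
  well as the shifted factors q z + (c - p).\<close>

lemma circle_mean_ln_affine:
  assumes "norm a * r \<noteq> norm b" "r > 0"
  shows "circle_mean r (\<lambda>z. ln (norm (a * z + b))) = ln (max (norm a * r) (norm b))"
proof (cases "a = 0")
  case True
  then show ?thesis using assms by (simp add: max_def)
next
  case False
  define d where "d = - b / a"
  have nd: "norm d = norm b / norm a" by (simp add: d_def norm_divide)
  have dr: "norm d \<noteq> r" using assms False by (auto simp: nd field_simps)
  have e: "ln (norm (a * z + b)) = ln (norm a) + ln (norm (z - d))" if "norm z = r" for z
  proof -
    have "a * z + b = a * (z - d)" using False by (simp add: d_def algebra_simps)
    moreover have "z \<noteq> d" using that dr by auto
    ultimately show ?thesis using False by (simp add: norm_mult ln_mult)
  qed
  have "circle_mean r (\<lambda>z. ln (norm (a * z + b))) = circle_mean r (\<lambda>z. ln (norm a) + ln (norm (z - d)))"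
    using assms by (intro circle_mean_cong e) auto
  also have "\<dots> = ln (norm a) + ln (max r (norm d))"
    using assms dr by (subst circle_mean_add) (auto intro!: continuous_intros simp: circle_mean_ln_norm)
  also have "\<dots> = ln (norm a * max r (norm d))"
    using assms False by (subst ln_mult) auto
  also have "norm a * max r (norm d) = max (norm a * r) (norm b)"
    using False by (simp add: nd max_def field_simps)
  finally show ?thesis .
qed

lemma ln_powi: "0 < x \<Longrightarrow> ln (x powi n) = real_of_int n * ln x"
  by (cases "n \<ge> 0") (auto simp: power_int_def ln_realpow ln_inverse)

lemma Re_complex_of_real_mult: "Re (of_real a * z) = a * Re z"
  by simp

lemma log_plus_nonneg [simp]: "0 \<le> log_plus x"
  by (simp add: log_plus_def)

lemma log_plus_eq: "0 < x \<Longrightarrow> log_plus x = max 0 (ln x)"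
  by (auto simp: log_plus_def max_def)

lemma log_plus_mono: "x \<le> y \<Longrightarrow> log_plus x \<le> log_plus y"
  by (simp add: log_plus_def)

lemma continuous_on_log_plus:
  fixes f :: "complex \<Rightarrow> complex"
  assumes "continuous_on S f"
  shows "continuous_on S (\<lambda>z. log_plus (norm (f z)))"
  unfolding log_plus_def by (intro continuous_intros assms) (auto simp: max_def)

lemma proximity_eq_circle_mean: "proximity r f = circle_mean r (\<lambda>z. log_plus (norm (f z)))"
  by (simp add: proximity_def circle_mean_def)

lemma proximity_nonneg: "r \<ge> 0 \<Longrightarrow> 0 \<le> proximity r f"
  unfolding proximity_eq_circle_mean by (intro circle_mean_nonneg) auto

text \<open>A non-integrable integrand has integral 0, which is below the nonnegative right-hand side.\<close>

lemma proximity_le_circle_mean: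
  assumes "r \<ge> 0" "continuous_on (sphere 0 r) h"
    and "\<And>z. norm z = r \<Longrightarrow> log_plus (norm (f z)) \<le> h z"
  shows "proximity r f \<le> circle_mean r h"
proof (cases "(\<lambda>t. log_plus (norm (f (of_real r * cis t)))) integrable_on {0..2*pi}")
  case True
  then show ?thesis
    unfolding proximity_eq_circle_mean circle_mean_def
    using integral_le[OF True circle_integrable[OF assms(2,1)]] assms
    by (simp add: norm_mult divide_right_mono)
next
  case False
  have "0 \<le> circle_mean r h"
    using assms by (intro circle_mean_nonneg) (auto intro: order_trans[OF log_plus_nonneg])
  then show ?thesis by (simp add: proximity_def not_integrable_integral[OF False])
qed

lemma minus_ln_blaschke_nonneg:
  assumes "norm p < R" "norm z \<le> R" "z \<noteq> p"
  shows "0 \<le> - ln (norm (blaschke R p z))"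
  using norm_blaschke_le_1[OF assms(1,2)] blaschke_eq_0_iff[of p R z] mult_less_square[OF assms(1,2)] assms
  by simp

lemma minus_ln_blaschke:
  assumes "norm p < R" "norm z \<le> R" "z \<noteq> p"
  shows "- ln (norm (blaschke R p z)) = ln (norm (of_real (R^2) - cnj p * z)) - ln R - ln (norm (z - p))"
proof -
  have R: "R > 0" using assms(1) norm_ge_zero[of p] by linarith
  have "of_real (R^2) - cnj p * z \<noteq> 0"
    using blaschke_denom mult_less_square[OF assms(1,2)] by blast
  then show ?thesis using R assms
    by (simp add: blaschke_def norm_mult norm_divide ln_div ln_mult del: of_real_power)
qed

text \<open>The denominator has modulus at most 2 R^2; what remains is ln |z - p|, whose circle mean
  is known.\<close>

lemma minus_ln_blaschke_le:
  assumes "norm p < R" "norm z \<le> R" "z \<noteq> p"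
  shows "- ln (norm (blaschke R p z)) \<le> ln (2 * R) - ln (norm (z - p))"
proof -
  have R: "R > 0" using assms(1) norm_ge_zero[of p] by linarith
  have nz: "of_real (R^2) - cnj p * z \<noteq> 0"
    using blaschke_denom mult_less_square[OF assms(1,2)] by blast
  have "norm (of_real (R^2) - cnj p * z) \<le> norm (of_real (R^2) :: complex) + norm (cnj p * z)"
    by (rule norm_triangle_ineq4)
  also have "\<dots> \<le> R^2 + R^2"
    using mult_less_square[OF assms(1,2)] by (simp add: norm_mult norm_power)
  finally have "norm (of_real (R^2) - cnj p * z) \<le> (2 * R) * R" by (simp add: power2_eq_square)
  then have "ln (norm (of_real (R^2) - cnj p * z)) \<le> ln ((2 * R) * R)"
    using nz R by (subst ln_le_cancel_iff) auto
  also have "\<dots> = ln (2 * R) + ln R" using R by (subst ln_mult) auto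
  finally show ?thesis unfolding minus_ln_blaschke[OF assms] by simp
qed

section \<open>The logarithm H of the zero-free part and the proximity functions\<close>

context nonzero_meromorphic
begin

definition is_schwarz_log :: "real \<Rightarrow> (complex \<Rightarrow> complex) \<Rightarrow> bool" where
  "is_schwarz_log R H \<longleftrightarrow> H holomorphic_on cball 0 R \<and>
     (\<forall>z. norm z \<le> R \<longrightarrow> z \<notin> bad g \<longrightarrow>
       g z = exp (H z) * (\<Prod>p\<in>bad g \<inter> ball 0 R. blaschke R p z powi zorder g p))"

lemma schwarz_log_exists: "good_radius g R \<Longrightarrow> \<exists>H. is_schwarz_log R H"
  using Schwarz_factorization[of R] unfolding is_schwarz_log_def by metis

lemma good_pos: "good_radius g R \<Longrightarrow> R > 0"
  by (simp add: good_radius_def)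

lemma good_not_bad: "good_radius g R \<Longrightarrow> norm z = R \<Longrightarrow> z \<notin> bad g"
  by (simp add: good_radius_def)

lemma not_bad_nonzero: "z \<notin> bad g \<Longrightarrow> g z \<noteq> 0"
  by (simp add: bad_def)

lemma continuous_on_not_bad: "S \<inter> bad g = {} \<Longrightarrow> continuous_on S g"
  by (intro continuous_at_imp_continuous_on) (auto simp: bad_def intro!: analytic_at_imp_isCont)

lemma ln_norm_factorization:
  assumes H: "is_schwarz_log R H" and z: "norm z \<le> R" "z \<notin> bad g"
  shows "ln (norm (g z)) = Re (H z) + (\<Sum>p\<in>bad g \<inter> ball 0 R. real_of_int (zorder g p) * ln (norm (blaschke R p z)))"
proof -
  have nz: "blaschke R p z \<noteq> 0" if "p \<in> bad g \<inter> ball 0 R" for p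
    using blaschke_eq_0_iff[of p R z] mult_less_square[of p R z] that z by auto
  have "ln (norm (g z)) = ln (norm (exp (H z)) * (\<Prod>p\<in>bad g \<inter> ball 0 R. norm (blaschke R p z) powi zorder g p))"
    using H z by (simp add: is_schwarz_log_def norm_mult prod_norm[symmetric] norm_power_int)
  also have "\<dots> = Re (H z) + ln (\<Prod>p\<in>bad g \<inter> ball 0 R. norm (blaschke R p z) powi zorder g p)"
    using nz by (subst ln_mult_pos) (auto intro!: prod_pos)
  also have "ln (\<Prod>p\<in>bad g \<inter> ball 0 R. norm (blaschke R p z) powi zorder g p)
     = (\<Sum>p\<in>bad g \<inter> ball 0 R. ln (norm (blaschke R p z) powi zorder g p))"
    using nz by (intro ln_prod) auto
  also have "\<dots> = (\<Sum>p\<in>bad g \<inter> ball 0 R. real_of_int (zorder g p) * ln (norm (blaschke R p z)))"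
    using nz by (intro sum.cong) (auto simp: ln_powi)
  finally show ?thesis .
qed

text \<open>The Blaschke factors are unimodular on |z| = R, so their logarithms drop out. This ties
  the boundary values of Re H to the proximity functions of g and 1/g.\<close>

lemma ln_norm_on_circle:
  assumes "is_schwarz_log R H" "good_radius g R" "norm z = R"
  shows "ln (norm (g z)) = Re (H z)"
proof -
  have "(\<Sum>p\<in>bad g \<inter> ball 0 R. real_of_int (zorder g p) * ln (norm (blaschke R p z))) = 0"
    using assms by (intro sum.neutral) (auto simp: norm_blaschke_circle)
  then show ?thesis
    using ln_norm_factorization[OF assms(1), of z] assms good_not_bad[OF assms(2,3)] by simp
qed

lemma schwarz_log_continuous:
  assumes "is_schwarz_log R H"
  shows "continuous_on (sphere 0 R) H"
  using assms unfolding is_schwarz_log_def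
  by (auto intro: continuous_on_subset[OF holomorphic_on_imp_continuous_on])

lemma proximity_schwarz_log:
  assumes "is_schwarz_log R H" "good_radius g R"
  shows "proximity R g = circle_mean R (\<lambda>z. max 0 (Re (H z)))"
    and "proximity R (\<lambda>z. 1 / g z) = circle_mean R (\<lambda>z. max 0 (- Re (H z)))"
proof -
  show "proximity R g = circle_mean R (\<lambda>z. max 0 (Re (H z)))"
    unfolding proximity_eq_circle_mean using assms good_pos[OF assms(2)]
    by (intro circle_mean_cong)
       (auto simp: log_plus_eq ln_norm_on_circle not_bad_nonzero good_not_bad)
  show "proximity R (\<lambda>z. 1 / g z) = circle_mean R (\<lambda>z. max 0 (- Re (H z)))"
    unfolding proximity_eq_circle_mean using assms good_pos[OF assms(2)]
    by (intro circle_mean_cong)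
       (auto simp: log_plus_eq norm_divide ln_div ln_norm_on_circle not_bad_nonzero good_not_bad)
qed

lemma proximity_sum:
  assumes "is_schwarz_log R H" "good_radius g R"
  shows "proximity R g + proximity R (\<lambda>z. 1 / g z) = circle_mean R (\<lambda>z. \<bar>Re (H z)\<bar>)"
proof -
  have "circle_mean R (\<lambda>z. \<bar>Re (H z)\<bar>) = circle_mean R (\<lambda>z. max 0 (Re (H z)) + max 0 (- Re (H z)))"
    by (intro arg_cong[where f = "circle_mean R"] ext) auto
  then show ?thesis
    unfolding proximity_schwarz_log[OF assms] using good_pos[OF assms(2)] schwarz_log_continuous[OF assms(1)]
    by (subst (asm) circle_mean_add) (auto intro!: continuous_intros)
qed

text \<open>Jensen's formula in raw form: the mean of ln |g| = Re H over the circle is Re (H 0) by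
  the mean value property. The evaluation of Re (H 0) is left to
  \<open>jensen_constant\<close>.\<close>

lemma proximity_diff:
  assumes "is_schwarz_log R H" "good_radius g R"
  shows "proximity R g - proximity R (\<lambda>z. 1 / g z) = Re (H 0)"
proof -
  have "circle_mean R (\<lambda>z. Re (H z)) = circle_mean R (\<lambda>z. max 0 (Re (H z)) - max 0 (- Re (H z)))"
    by (intro arg_cong[where f = "circle_mean R"] ext) auto
  moreover have "circle_mean R (\<lambda>z. Re (H z)) = Re (H 0)"
    using assms good_pos[OF assms(2)] by (intro circle_mean_Re_holomorphic) (auto simp: is_schwarz_log_def)
  ultimately show ?thesis
    unfolding proximity_schwarz_log[OF assms] using good_pos[OF assms(2)] schwarz_log_continuous[OF assms(1)]
    by (subst (asm) circle_mean_diff) (auto intro!: continuous_intros)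
qed

lemma Re_schwarz_log_le:
  assumes H: "is_schwarz_log R H" and R: "good_radius g R" and z: "2 * norm z \<le> R"
  shows "Re (H z) \<le> 3 * proximity R g"
proof -
  have R0: "R > 0" using good_pos[OF R] .
  have zR: "norm z < R" using z R0 by linarith
  have ne: "w \<noteq> z" if "norm w = R" for w using that zR by auto
  have cH: "continuous_on (sphere 0 R) H" by (rule schwarz_log_continuous[OF H])
  have "Re (H z) = Re (H z - \<i> * of_real (Im (H 0)))" by simp
  also have "H z - \<i> * of_real (Im (H 0)) = circle_mean R (\<lambda>w. of_real (Re (H w)) * ((w + z) / (w - z)))"
    using H zR by (subst circle_mean_Schwarz) (auto simp: is_schwarz_log_def)
  also have "Re \<dots> = circle_mean R (\<lambda>w. Re (of_real (Re (H w)) * ((w + z) / (w - z))))"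
    using ne R0 by (intro circle_mean_bounded_linear[symmetric] bounded_linear_Re)
      (auto intro!: continuous_intros cH)
  also have "\<dots> \<le> circle_mean R (\<lambda>w. 3 * max 0 (Re (H w)))"
  proof (intro circle_mean_mono)
    fix w :: complex assume w: "norm w = R"
    have wz: "norm (w - z) > 0" using ne[OF w] by simp
    have "(w + z) / (w - z) = (w + z) * cnj (w - z) / of_real (norm (w - z) ^ 2)"
      by (metis complex_div_cnj of_real_power)
    then have "Re ((w + z) / (w - z)) = Re ((w + z) * cnj (w - z)) / norm (w - z) ^ 2"
      by (simp only: Re_divide_of_real)
    also have "Re ((w + z) * cnj (w - z)) = norm w ^ 2 - norm z ^ 2"
      by (simp only: cmod_power2) (simp add: algebra_simps power2_eq_square)
    finally have "Re ((w + z) / (w - z)) \<ge> 0" using w zR by (simp add: power_mono)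
    moreover have "Re ((w + z) / (w - z)) \<le> 3"
    proof -
      have "norm (w + z) \<le> R + norm z" using norm_triangle_ineq[of w z] w by simp
      moreover have "R - norm z \<le> norm (w - z)" using norm_triangle_ineq2[of w z] w by simp
      ultimately have "norm (w + z) \<le> 3 * norm (w - z)" using z by linarith
      then have "norm ((w + z) / (w - z)) \<le> 3" using wz by (simp add: norm_divide field_simps)
      then show ?thesis using complex_Re_le_cmod[of "(w + z) / (w - z)"] by linarith
    qed
    ultimately have "max 0 (Re (H w)) * Re ((w + z) / (w - z)) \<le> max 0 (Re (H w)) * 3"
      by (intro mult_left_mono) auto
    moreover have "Re (H w) * Re ((w + z) / (w - z)) \<le> max 0 (Re (H w)) * Re ((w + z) / (w - z))"
      using \<open>Re ((w + z) / (w - z)) \<ge> 0\<close> by (intro mult_right_mono) auto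
    ultimately have "Re (H w) * Re ((w + z) / (w - z)) \<le> max 0 (Re (H w)) * 3" by linarith
    then show "Re (of_real (Re (H w)) * ((w + z) / (w - z))) \<le> 3 * max 0 (Re (H w))"
      unfolding Re_complex_of_real_mult by linarith
  qed (use ne R0 in \<open>auto intro!: continuous_intros cH\<close>)
  finally show ?thesis unfolding proximity_schwarz_log(1)[OF H R] circle_mean_cmult .
qed

text \<open>Subtracting the Schwarz formulas at z and at 0 cancels the imaginary constant and leaves
  the kernel 2 z/(w - z), of modulus at most 4 r/R since |w - z| >= R/2. Comparing both points with
  0 doubles this to 8 r/R.\<close>

lemma schwarz_log_diff:
  assumes H: "is_schwarz_log R H" and R: "good_radius g R" and z: "norm z \<le> r" "norm z' \<le> r" "2 * r \<le> R"
  shows "norm (H z - H z') \<le> 8 * r / R * (proximity R g + proximity R (\<lambda>z. 1 / g z))"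
proof -
  have R0: "R > 0" using good_pos[OF R] .
  have cH: "continuous_on (sphere 0 R) H" by (rule schwarz_log_continuous[OF H])
  define M where "M = circle_mean R (\<lambda>z. \<bar>Re (H z)\<bar>)"
  have M0: "M \<ge> 0" unfolding M_def using R0 by (intro circle_mean_nonneg) auto
  have *: "norm (H z - H 0) \<le> 4 * r / R * M" if z: "norm z \<le> r" for z
  proof -
    have zR: "norm z < R" using z \<open>2 * r \<le> R\<close> R0 by linarith
    have ne: "w \<noteq> z" "w \<noteq> 0" if "norm w = R" for w using that zR R0 by auto
    have hol: "H holomorphic_on cball 0 R" using H by (simp add: is_schwarz_log_def)
    have "H z - H 0 = circle_mean R (\<lambda>w. of_real (Re (H w)) * ((w + z) / (w - z)))
        - circle_mean R (\<lambda>w. of_real (Re (H w)) * ((w + 0) / (w - 0)))"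
      using circle_mean_Schwarz[OF hol zR] circle_mean_Schwarz[OF hol, of 0] R0 by simp
    also have "\<dots> = circle_mean R (\<lambda>w. of_real (Re (H w)) * ((w + z) / (w - z)) - of_real (Re (H w)) * ((w + 0) / (w - 0)))"
      by (intro circle_mean_diff[symmetric] continuous_intros cH) (use ne R0 in auto)
    also have "\<dots> = circle_mean R (\<lambda>w. of_real (Re (H w)) * (2 * z / (w - z)))"
    proof (intro circle_mean_cong)
      fix w :: complex assume w: "norm w = R"
      have "(w + z) / (w - z) - (w + 0) / (w - 0) = 2 * z / (w - z)"
        using ne[OF w] by (simp add: field_simps)
      then show "of_real (Re (H w)) * ((w + z) / (w - z)) - of_real (Re (H w)) * ((w + 0) / (w - 0))
          = of_real (Re (H w)) * (2 * z / (w - z))"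
        by (metis right_diff_distrib)
    qed (use R0 in auto)
    also have "norm \<dots> \<le> circle_mean R (\<lambda>w. norm (of_real (Re (H w)) * (2 * z / (w - z))))"
      using ne R0 by (intro circle_mean_norm_le) (auto intro!: continuous_intros cH)
    also have "\<dots> \<le> circle_mean R (\<lambda>w. 4 * r / R * \<bar>Re (H w)\<bar>)"
    proof (intro circle_mean_mono)
      fix w :: complex assume w: "norm w = R"
      have "R / 2 \<le> norm (w - z)" using norm_triangle_ineq2[of w z] w z \<open>2 * r \<le> R\<close> by simp
      then have "norm (2 * z / (w - z)) \<le> (2 * r) / (R / 2)"
        unfolding norm_divide using z R0 order_trans[OF norm_ge_zero z]
        by (intro frac_le) (auto simp: norm_mult)
      then have "norm (2 * z / (w - z)) \<le> 4 * r / R" by simp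
      then show "norm (of_real (Re (H w)) * (2 * z / (w - z))) \<le> 4 * r / R * \<bar>Re (H w)\<bar>"
        unfolding norm_mult by (simp only: norm_of_real mult.commute[of "\<bar>Re (H w)\<bar>"]) (rule mult_right_mono, auto)
    qed (use ne R0 in \<open>auto intro!: continuous_intros cH\<close>)
    finally show ?thesis unfolding circle_mean_cmult M_def .
  qed
  have "norm (H z - H z') \<le> norm (H z - H 0) + norm (H z' - H 0)"
    using norm_triangle_ineq4[of "H z - H 0" "H z' - H 0"] by simp
  also have "\<dots> \<le> 4 * r / R * M + 4 * r / R * M" using * z by (intro add_mono) auto
  finally show ?thesis unfolding proximity_sum[OF H R] M_def by (simp add: algebra_simps)
qed

end

lemma circle_mean_const_plus_sum:
  fixes f :: "'i \<Rightarrow> complex \<Rightarrow> 'a::banach"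
  assumes "\<And>i. i \<in> I \<Longrightarrow> continuous_on (sphere 0 r) (f i)" "r \<ge> 0"
  shows "circle_mean r (\<lambda>z. c + (\<Sum>i\<in>I. f i z)) = c + (\<Sum>i\<in>I. circle_mean r (f i))"
  using assms by (subst circle_mean_add) (auto simp: circle_mean_sum intro: continuous_on_sum)

section \<open>Jensen's formula and the counting of zeros and poles\<close>

context nonzero_meromorphic
begin

text \<open>As \<open>ln 0 = 0\<close>, a point \<open>p = 0\<close> contributes \<open>ln R\<close>, which is the usual convention.\<close>

definition point_counting :: "real \<Rightarrow> (int \<Rightarrow> real) \<Rightarrow> real" where
  "point_counting R w = (\<Sum>p\<in>bad g \<inter> ball 0 R. w (zorder g p) * (ln R - ln (norm p)))"

text \<open>For p = 0 the convention ln 0 = 0 leaves ln R, whose sign comes from 1 <= R.\<close>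

lemma ln_quotient_ge:
  assumes "norm (p::complex) < R" "1 \<le> R"
  shows "0 \<le> ln R - ln (norm p)"
  using assms by (cases "p = 0") auto

text \<open>The limit at 0 of ln |g w| - zorder g 0 * ln |w| is computed twice. The Laurent
  expansion gives the logarithm of the modulus of the leading coefficient; the factorization gives
  Re (H 0) plus the Blaschke terms at 0.\<close>

lemma jensen_constant: 
  assumes R: "good_radius g R" and H: "is_schwarz_log R H"
  shows "Re (H 0) = ln (norm (zor_poly g 0 0)) + point_counting R real_of_int"
proof -
  let ?P = "bad g \<inter> ball 0 R"
  let ?n = "\<lambda>p. real_of_int (zorder g p)"
  have R0: "R > 0" using good_pos[OF R] .
  obtain e where e: "zor_poly g 0 0 \<noteq> 0" "e > 0" "zor_poly g 0 holomorphic_on cball 0 e"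
      "\<And>w. w \<in> cball 0 e - {0} \<Longrightarrow> g w = zor_poly g 0 w * w powi zorder g 0 \<and> zor_poly g 0 w \<noteq> 0"
    using zorder_exist[of g 0] mero_at[of 0] frequently_nonzero[of 0] by (auto simp: meromorphic_at_iff)
  define F where "F = (\<lambda>w. ln (norm (g w)) - ?n 0 * ln (norm w))"
  have "isCont (zor_poly g 0) 0"
    using e(2,3) by (intro continuous_on_interior[of "cball 0 e"] holomorphic_on_imp_continuous_on) auto
  then have "((\<lambda>w. ln (norm (zor_poly g 0 w))) \<longlongrightarrow> ln (norm (zor_poly g 0 0))) (at 0)"
    using e(1) by (intro tendsto_intros) (auto simp: isCont_def)
  moreover have "\<forall>\<^sub>F w in at 0. ln (norm (zor_poly g 0 w)) = F w"
  proof -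
    have "\<forall>\<^sub>F w in at 0. w \<in> ball 0 e - {0}"
      using e(2) by (intro eventually_at_in_open) auto
    then show ?thesis
    proof eventually_elim
      case (elim w)
      then have "g w = zor_poly g 0 w * w powi zorder g 0" "zor_poly g 0 w \<noteq> 0" "w \<noteq> 0"
        using e(4)[of w] by auto
      then show ?case by (simp add: F_def norm_mult norm_power_int ln_mult ln_powi)
    qed
  qed
  ultimately have lim1: "(F \<longlongrightarrow> ln (norm (zor_poly g 0 0))) (at 0)"
    using tendsto_cong by fast
  have "((\<lambda>w. Re (H w) + (\<Sum>p\<in>?P - {0}. ?n p * ln (norm (blaschke R p w))) - ?n 0 * ln R) \<longlongrightarrow>
      Re (H 0) + (\<Sum>p\<in>?P - {0}. ?n p * ln (norm (blaschke R p 0))) - ?n 0 * ln R) (at 0)"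
  proof (intro tendsto_intros)
    show "(H \<longlongrightarrow> H 0) (at 0)"
      using H R0 unfolding is_schwarz_log_def
      by (intro isContD continuous_on_interior[of "cball 0 R"] holomorphic_on_imp_continuous_on) auto
    fix p assume p: "p \<in> ?P - {0}"
    have a: "norm p * norm (0::complex) < R^2" using R0 by simp
    show "blaschke R p \<midarrow>0\<rightarrow> blaschke R p 0"
      using blaschke_analytic[OF a] by (intro isContD analytic_at_imp_isCont)
    show "norm (blaschke R p 0) \<noteq> 0"
      using blaschke_eq_0_iff[OF _ a] p by auto
  qed
  moreover have "\<forall>\<^sub>F w in at 0. Re (H w) + (\<Sum>p\<in>?P - {0}. ?n p * ln (norm (blaschke R p w))) - ?n 0 * ln R = F w"
  proof -
    have "\<forall>\<^sub>F w in at 0. w \<in> ball 0 R - {0}"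
      using R0 by (intro eventually_at_in_open) auto
    with eventually_not_bad[of 0] show ?thesis
    proof eventually_elim
      case (elim w)
      \<comment> \<open>The factor for p = 0 is w/R: its ln |w| cancels against the term subtracted
        in \<open>F\<close> and leaves -ln R. If 0 is not bad, then zorder g 0 = 0 and the extra
        term vanishes.\<close>
      have "(\<Sum>p\<in>?P. ?n p * ln (norm (blaschke R p w)))
          = (\<Sum>p\<in>?P - {0}. ?n p * ln (norm (blaschke R p w))) + ?n 0 * (ln (norm w) - ln R)"
      proof (cases "0 \<in> bad g")
        case True
        have "blaschke R 0 w = w / of_real R" using R0 by (simp add: blaschke_def power2_eq_square)
        then have "ln (norm (blaschke R 0 w)) = ln (norm w) - ln R"
          using R0 elim by (simp add: norm_divide ln_div)
        then show ?thesis using True R0 by (subst sum.remove[of _ 0]) auto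
      next
        case False
        then have "?P - {0} = ?P" by auto
        then show ?thesis using not_bad_zorder[OF False] by simp
      qed
      then show ?case
        using ln_norm_factorization[OF H, of w] elim by (simp add: F_def algebra_simps)
    qed
  qed
  ultimately have lim2: "(F \<longlongrightarrow> Re (H 0) + (\<Sum>p\<in>?P - {0}. ?n p * ln (norm (blaschke R p 0))) - ?n 0 * ln R) (at 0)"
    using tendsto_cong by fast
  have "ln (norm (zor_poly g 0 0)) = Re (H 0) + (\<Sum>p\<in>?P - {0}. ?n p * ln (norm (blaschke R p 0))) - ?n 0 * ln R"
    by (rule tendsto_unique[OF _ lim1 lim2]) simp
  also have "(\<Sum>p\<in>?P - {0}. ?n p * ln (norm (blaschke R p 0))) = (\<Sum>p\<in>?P - {0}. - (?n p * (ln R - ln (norm p))))"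
  proof (intro sum.cong refl)
    fix p assume p: "p \<in> ?P - {0}"
    have "norm (blaschke R p 0) = norm p / R"
      using R0 by (simp add: blaschke_def norm_mult norm_divide norm_power power2_eq_square)
    then show "?n p * ln (norm (blaschke R p 0)) = - (?n p * (ln R - ln (norm p)))"
      using p R0 by (simp add: ln_div algebra_simps)
  qed
  also have "\<dots> = - (point_counting R real_of_int - ?n 0 * ln R)"
  proof (cases "0 \<in> bad g")
    case True
    then show ?thesis unfolding point_counting_def using R0
      by (subst sum.remove[of _ 0]) (auto simp: sum_negf)
  next
    case False
    then have "?P - {0} = ?P" by auto
    then show ?thesis using not_bad_zorder[OF False] by (simp add: point_counting_def sum_negf)
  qed
  finally show ?thesis by simp
qed

definition pole_weight :: "int \<Rightarrow> real" where "pole_weight n = max 0 (- real_of_int n)"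
definition zero_weight :: "int \<Rightarrow> real" where "zero_weight n = max 0 (real_of_int n)"

lemma weights_nonneg [simp]: "0 \<le> pole_weight n" "0 \<le> zero_weight n"
  by (auto simp: pole_weight_def zero_weight_def)

lemma weights_add: "pole_weight n + zero_weight n = \<bar>real_of_int n\<bar>"
  by (auto simp: pole_weight_def zero_weight_def)

lemma point_counting_nonneg:
  assumes "1 \<le> R" "\<And>n. 0 \<le> w n"
  shows "0 \<le> point_counting R w"
  unfolding point_counting_def using assms
  by (intro sum_nonneg mult_nonneg_nonneg ln_quotient_ge) auto

text \<open>Jensen's formula with each order split into its positive and negative part.\<close>

lemma first_fundamental_theorem:
  assumes R: "good_radius g R"
  shows "proximity R g + point_counting R pole_weight =
    proximity R (\<lambda>z. 1 / g z) + point_counting R zero_weight + ln (norm (zor_poly g 0 0))"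
proof -
  obtain H where H: "is_schwarz_log R H" using schwarz_log_exists[OF R] by blast
  have "point_counting R real_of_int = point_counting R zero_weight - point_counting R pole_weight"
    unfolding point_counting_def sum_subtractf[symmetric] left_diff_distrib[symmetric]
    by (intro sum.cong refl) (auto simp: pole_weight_def zero_weight_def max_def)
  then show ?thesis
    using proximity_diff[OF H R] jensen_constant[OF R H] by simp
qed

text \<open>Stand-in for the characteristic in which the counting function is a finite sum;
  \<open>characteristic_eq_nev\<close> identifies the two on good radii.\<close>

definition nev :: "real \<Rightarrow> real" where
  "nev R = proximity R g + point_counting R pole_weight"

definition nev_const :: real where
  "nev_const = \<bar>ln (norm (zor_poly g 0 0))\<bar>"

text \<open>The first fundamental theorem bounds the proximity of 1/g and the counting of zeros by
  the same quantity as their counterparts for g, at the additive cost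
  \<open>nev_const\<close>.\<close>

lemma nev_bounds:
  assumes R: "good_radius g R" "1 \<le> R"
  shows "0 \<le> nev R"
    and "proximity R g + proximity R (\<lambda>z. 1 / g z) \<le> 2 * nev R + nev_const"
    and "point_counting R (\<lambda>n. \<bar>real_of_int n\<bar>) \<le> 2 * nev R + nev_const"
proof -
  have *: "0 \<le> point_counting R pole_weight" "0 \<le> point_counting R zero_weight"
    "0 \<le> proximity R g" "0 \<le> proximity R (\<lambda>z. 1 / g z)"
    using R good_pos[OF R(1)] by (auto intro!: point_counting_nonneg proximity_nonneg)
  then show "0 \<le> nev R" by (simp add: nev_def)
  have arith: "a + b \<le> 2 * (a + c) + \<bar>l\<bar>" "c + d \<le> 2 * (a + c) + \<bar>l\<bar>"
    if "a + c = b + d + l" "0 \<le> c" "0 \<le> d" "0 \<le> a" "0 \<le> b" for a b c d l :: real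
    using that unfolding distrib_left by linarith+
  show "proximity R g + proximity R (\<lambda>z. 1 / g z) \<le> 2 * nev R + nev_const"
    unfolding nev_def nev_const_def by (rule arith(1)[OF first_fundamental_theorem[OF R(1)] *])
  have "point_counting R (\<lambda>n. \<bar>real_of_int n\<bar>) = point_counting R pole_weight + point_counting R zero_weight"
    by (simp add: point_counting_def weights_add[symmetric] distrib_right sum.distrib)
  then show "point_counting R (\<lambda>n. \<bar>real_of_int n\<bar>) \<le> 2 * nev R + nev_const"
    unfolding nev_def nev_const_def
    using arith(2)[OF first_fundamental_theorem[OF R(1)] *] by simp
qed

text \<open>A point of modulus below R contributes at least ln (R'/R) per unit of multiplicity to
  the counting sum at R'; for p = 0 this relies on 1 <= R.\<close>

lemma multiplicity_bound:
  assumes R: "good_radius g R'" "1 \<le> R" "R \<le> R'"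
  shows "(\<Sum>p\<in>bad g \<inter> ball 0 R. \<bar>real_of_int (zorder g p)\<bar>) * (ln R' - ln R) \<le> 2 * nev R' + nev_const"
proof -
  have "(\<Sum>p\<in>bad g \<inter> ball 0 R. \<bar>real_of_int (zorder g p)\<bar>) * (ln R' - ln R)
     \<le> (\<Sum>p\<in>bad g \<inter> ball 0 R. \<bar>real_of_int (zorder g p)\<bar> * (ln R' - ln (norm p)))"
    unfolding sum_distrib_right
  proof (intro sum_mono mult_left_mono)
    fix p assume p: "p \<in> bad g \<inter> ball 0 R"
    show "ln R' - ln R \<le> ln R' - ln (norm p)"
      using ln_quotient_ge[of p R] p R by auto
  qed auto
  also have "\<dots> \<le> point_counting R' (\<lambda>n. \<bar>real_of_int n\<bar>)"
    unfolding point_counting_def using R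
    by (intro sum_mono2) (auto intro!: mult_nonneg_nonneg ln_quotient_ge[simplified])
  also have "\<dots> \<le> 2 * nev R' + nev_const" using R by (intro nev_bounds) auto
  finally show ?thesis .
qed

text \<open>A substitute for the monotonicity of T. On |z| = r, ln+ |g| is at most 3 m(R, g) plus
  pole terms -ln |blaschke|, whose circle means add up to exactly N(R, g) - N(r, g). So the factor 3
  is really spent on the proximity part alone.\<close>

lemma nev_quasi_mono:
  assumes r: "good_radius g r" and R: "good_radius g R" and rR: "2 * r \<le> R"  "1 \<le> R"
  shows "nev r \<le> 3 * nev R"
proof -
  obtain H where H: "is_schwarz_log R H" using schwarz_log_exists[OF R] by blast
  let ?P = "bad g \<inter> ball 0 R"
  let ?a = "\<lambda>p. pole_weight (zorder g p)"
  have r0: "r > 0" using good_pos[OF r] .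
  have R0: "R > 0" using good_pos[OF R] .
  have nzr: "of_real (R^2) - cnj p * z \<noteq> 0" if "p \<in> ?P" "norm z = r" for p z
    using blaschke_denom mult_less_square[of p R z] that rR r0 by auto
  have nep: "z \<noteq> p" if "p \<in> ?P" "norm z = r" for p z
    using that good_not_bad[OF r, of p] by auto
  \<comment> \<open>The Blaschke terms are split into separate logarithms, because the circle means
    of these are known.\<close>
  define h where "h = (\<lambda>z. 3 * proximity R g +
     (\<Sum>p\<in>?P. ?a p * (ln (norm (of_real (R^2) - cnj p * z)) - ln R - ln (norm (z - p)))))"
  have cont: "continuous_on (sphere 0 r) (\<lambda>z. ln (norm (of_real (R^2) - cnj p * z)))"
     "continuous_on (sphere 0 r) (\<lambda>z. ln (norm (z - p)))" if "p \<in> ?P" for p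
    using nzr[OF that] nep[OF that] by (auto intro!: continuous_intros simp del: of_real_power)
  have le: "log_plus (norm (g z)) \<le> h z" if z: "norm z = r" for z
  proof -
    have nb: "z \<notin> bad g" using good_not_bad[OF r z] .
    have bl: "0 \<le> - ln (norm (blaschke R p z))" "- ln (norm (blaschke R p z)) =
       ln (norm (of_real (R^2) - cnj p * z)) - ln R - ln (norm (z - p))" if p: "p \<in> ?P" for p
    proof -
      have "norm p < R" "norm z \<le> R" using p z rR r0 by auto
      then show "0 \<le> - ln (norm (blaschke R p z))" "- ln (norm (blaschke R p z)) =
       ln (norm (of_real (R^2) - cnj p * z)) - ln R - ln (norm (z - p))"
        using nep[OF p z] by (intro minus_ln_blaschke_nonneg minus_ln_blaschke; simp)+
    qed
    have hz: "h z = 3 * proximity R g + (\<Sum>p\<in>?P. ?a p * (- ln (norm (blaschke R p z))))"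
      unfolding h_def by (intro arg_cong2[where f = plus] refl sum.cong) (simp only: bl)
    have "0 \<le> h z" unfolding hz using R0
      by (intro add_nonneg_nonneg mult_nonneg_nonneg sum_nonneg proximity_nonneg bl) auto
    moreover have "ln (norm (g z)) \<le> h z"
    proof -
      have "ln (norm (g z)) = Re (H z) + (\<Sum>p\<in>?P. real_of_int (zorder g p) * ln (norm (blaschke R p z)))"
        using z rR r0 nb by (intro ln_norm_factorization[OF H]) auto
      \<comment> \<open>Zeros only lower ln |g| inside the disc and are discarded; the pole weight
        survives.\<close>
      also have "(\<Sum>p\<in>?P. real_of_int (zorder g p) * ln (norm (blaschke R p z)))
         \<le> (\<Sum>p\<in>?P. ?a p * (- ln (norm (blaschke R p z))))"
      proof (intro sum_mono)
        fix p assume p: "p \<in> ?P"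
        have "- real_of_int (zorder g p) * (- ln (norm (blaschke R p z))) \<le> ?a p * (- ln (norm (blaschke R p z)))"
          using bl(1)[OF p] by (intro mult_right_mono) (auto simp: pole_weight_def)
        then show "real_of_int (zorder g p) * ln (norm (blaschke R p z)) \<le> ?a p * (- ln (norm (blaschke R p z)))"
          by simp
      qed
      also have "Re (H z) \<le> 3 * proximity R g"
        using z rR by (intro Re_schwarz_log_le[OF H R]) auto
      finally show ?thesis unfolding hz by simp
    qed
    ultimately show ?thesis using not_bad_nonzero[OF nb] by (simp add: log_plus_eq)
  qed
  have ch: "continuous_on (sphere 0 r) h" unfolding h_def by (intro continuous_intros cont)
  \<comment> \<open>The mean is the logarithm of the larger of |p| r and R^2, and |p| r <
    R^2.\<close>
  have m1: "circle_mean r (\<lambda>z. ln (norm (of_real (R^2) - cnj p * z))) = 2 * ln R" if p: "p \<in> ?P" for p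
  proof -
    have "norm p * r < R^2" using mult_less_square[of p R "of_real r"] p rR r0 mult_less_square[of p R r] by auto
    then show ?thesis
      using circle_mean_ln_affine[of "- cnj p" r "of_real (R^2)"] r0 R0
      by (simp add: norm_power max_def ln_realpow)
  qed
  have m2: "circle_mean r (\<lambda>z. ln (norm (z - p))) = ln (max r (norm p))" if p: "p \<in> ?P" for p
    using p good_not_bad[OF r, of p] r0 by (intro circle_mean_ln_norm) auto
  have "proximity r g \<le> circle_mean r h"
    using r0 ch le by (intro proximity_le_circle_mean) auto
  also have "circle_mean r h = 3 * proximity R g +
     (\<Sum>p\<in>?P. circle_mean r (\<lambda>z. ?a p * (ln (norm (of_real (R^2) - cnj p * z)) - ln R - ln (norm (z - p)))))"
    unfolding h_def by (intro circle_mean_const_plus_sum continuous_intros cont less_imp_le[OF r0])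
  also have "(\<Sum>p\<in>?P. circle_mean r (\<lambda>z. ?a p * (ln (norm (of_real (R^2) - cnj p * z)) - ln R - ln (norm (z - p)))))
     = (\<Sum>p\<in>?P. ?a p * (ln R - ln (max r (norm p))))"
  proof (intro sum.cong refl)
    fix p assume p: "p \<in> ?P"
    have "circle_mean r (\<lambda>z. ln (norm (of_real (R^2) - cnj p * z)) - ln R - ln (norm (z - p)))
      = 2 * ln R - ln R - ln (max r (norm p))"
      by (simp only: circle_mean_diff circle_mean_const cont[OF p] continuous_on_diff
          continuous_on_const less_imp_le[OF r0] m1[OF p] m2[OF p])
    then show "circle_mean r (\<lambda>z. ?a p * (ln (norm (of_real (R^2) - cnj p * z)) - ln R - ln (norm (z - p))))
      = ?a p * (ln R - ln (max r (norm p)))"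
      unfolding circle_mean_cmult by simp
  qed
  finally have 1: "proximity r g \<le> 3 * proximity R g + (\<Sum>p\<in>?P. ?a p * (ln R - ln (max r (norm p))))" .
  have "point_counting r pole_weight = (\<Sum>p\<in>?P. if norm p < r then ?a p * (ln r - ln (norm p)) else 0)"
    unfolding point_counting_def using rR r0
    by (intro sum.mono_neutral_cong_left) auto
  also have "\<dots> + (\<Sum>p\<in>?P. ?a p * (ln R - ln (max r (norm p)))) = point_counting R pole_weight"
    unfolding point_counting_def sum.distrib[symmetric]
    by (intro sum.cong refl) (auto simp: max_def algebra_simps)
  finally have 2: "point_counting r pole_weight + (\<Sum>p\<in>?P. ?a p * (ln R - ln (max r (norm p)))) = point_counting R pole_weight" .
  have "0 \<le> point_counting R pole_weight" using rR by (intro point_counting_nonneg) auto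
  moreover have "a + c \<le> 3 * (b + d)" if "a \<le> 3 * b + x" "c + x = d" "0 \<le> d" for a b c d x :: real
    using that unfolding distrib_left by linarith
  ultimately show ?thesis using 1 2 unfolding nev_def by blast
qed

text \<open>With w = q z + c, ln |g(w)/g(z)| is Re (H w - H z) plus differences of Blaschke
  logarithms. The first part is handled by \<open>schwarz_log_diff\<close>. The second is majorized
  by logarithms singular at p and at its preimage, whose circle means are at least ln r and ln (|q|
  r); so each point costs at most 2 ln (2 R) - ln (|q| r) - ln r per unit of multiplicity.\<close>

lemma proximity_shift_quotient:
  assumes r: "good_radius g r" and R: "good_radius g R" and rR: "2 * r \<le> R"
    and q: "0 < norm q" "norm q \<le> 1" "norm q * r + norm c \<le> r"
    and img: "\<And>z. norm z = r \<Longrightarrow> q * z + c \<notin> bad g"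
  shows "proximity r (\<lambda>z. g (q * z + c) / g z) \<le>
    8 * r / R * (proximity R g + proximity R (\<lambda>z. 1 / g z)) +
    (\<Sum>p\<in>bad g \<inter> ball 0 R. \<bar>real_of_int (zorder g p)\<bar>) * (2 * ln (2 * R) - ln (norm q * r) - ln r)"
proof -
  obtain H where H: "is_schwarz_log R H" using schwarz_log_exists[OF R] by blast
  let ?P = "bad g \<inter> ball 0 R"
  let ?a = "\<lambda>p. \<bar>real_of_int (zorder g p)\<bar>"
  define A where "A = 8 * r / R * (proximity R g + proximity R (\<lambda>z. 1 / g z))"
  have r0: "r > 0" using good_pos[OF r] .
  have R0: "R > 0" using good_pos[OF R] .
  have A0: "A \<ge> 0" unfolding A_def using r0 R0
    by (intro mult_nonneg_nonneg add_nonneg_nonneg proximity_nonneg) auto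
  have nep: "z \<noteq> p" "q * z + c \<noteq> p" if "p \<in> ?P" "norm z = r" for p z
    using that good_not_bad[OF r, of p] img[of z] by auto
  have img_le: "norm (q * z + c) \<le> r" if "norm z = r" for z
    using norm_triangle_ineq[of "q * z" c] q that by (simp add: norm_mult)
  define h where "h = (\<lambda>z. A + (\<Sum>p\<in>?P. ?a p *
     ((ln (2 * R) - ln (norm (z - p))) + (ln (2 * R) - ln (norm (q * z + (c - p)))))))"
  have cont: "continuous_on (sphere 0 r) (\<lambda>z. ln (norm (q * z + (c - p))))"
     "continuous_on (sphere 0 r) (\<lambda>z. ln (norm (z - p)))" if "p \<in> ?P" for p
    using nep[OF that] by (auto intro!: continuous_intros simp: algebra_simps)
  have le: "log_plus (norm (g (q * z + c) / g z)) \<le> h z" if z: "norm z = r" for z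
  proof -
    define w where "w = q * z + c"
    have nb: "z \<notin> bad g" "w \<notin> bad g" using good_not_bad[OF r z] img[OF z] by (auto simp: w_def)
    have zR: "norm z \<le> R" "norm w \<le> R" using z img_le[OF z] rR r0 by (auto simp: w_def)
    have bl: "0 \<le> - ln (norm (blaschke R p z))" "0 \<le> - ln (norm (blaschke R p w))"
      "- ln (norm (blaschke R p z)) \<le> ln (2 * R) - ln (norm (z - p))"
      "- ln (norm (blaschke R p w)) \<le> ln (2 * R) - ln (norm (w - p))" if p: "p \<in> ?P" for p
      using nep[OF p z] zR p
      by (intro minus_ln_blaschke_nonneg minus_ln_blaschke_le; simp add: w_def)+
    have hz: "h z = A + (\<Sum>p\<in>?P. ?a p *
       ((ln (2 * R) - ln (norm (z - p))) + (ln (2 * R) - ln (norm (w - p)))))"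
      by (simp add: h_def w_def algebra_simps)
    have "0 \<le> (\<Sum>p\<in>?P. ?a p *
       ((ln (2 * R) - ln (norm (z - p))) + (ln (2 * R) - ln (norm (w - p)))))"
    proof (intro sum_nonneg mult_nonneg_nonneg)
      fix p assume p: "p \<in> ?P"
      show "0 \<le> (ln (2 * R) - ln (norm (z - p))) + (ln (2 * R) - ln (norm (w - p)))"
        using bl[OF p] by linarith
    qed auto
    then have "0 \<le> h z" unfolding hz using A0 by linarith
    moreover have "ln (norm (g w)) - ln (norm (g z)) \<le> h z"
    proof -
      have "ln (norm (g w)) - ln (norm (g z)) = Re (H w - H z) +
         (\<Sum>p\<in>?P. real_of_int (zorder g p) * (ln (norm (blaschke R p w)) - ln (norm (blaschke R p z))))"
        using ln_norm_factorization[OF H zR(1) nb(1)] ln_norm_factorization[OF H zR(2) nb(2)]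
        by (simp add: right_diff_distrib sum_subtractf)
      also have "Re (H w - H z) \<le> A"
        using schwarz_log_diff[OF H R, of w r z] complex_Re_le_cmod[of "H w - H z"] img_le[OF z] z rR
        unfolding w_def A_def by linarith
      also have "(\<Sum>p\<in>?P. real_of_int (zorder g p) * (ln (norm (blaschke R p w)) - ln (norm (blaschke R p z))))
        \<le> (\<Sum>p\<in>?P. ?a p * ((ln (2 * R) - ln (norm (z - p))) + (ln (2 * R) - ln (norm (w - p)))))"
      proof (intro sum_mono)
        fix p assume p: "p \<in> ?P"
        let ?d = "ln (norm (blaschke R p w)) - ln (norm (blaschke R p z))"
        \<comment> \<open>Both negated Blaschke logarithms are nonnegative, so the modulus of their
          difference is at most their sum, whatever the sign of the order.\<close>
        have "real_of_int (zorder g p) * ?d \<le> ?a p * \<bar>?d\<bar>"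
          using abs_ge_self[of "real_of_int (zorder g p) * ?d"] by (simp only: abs_mult)
        also have "\<dots> \<le> ?a p * ((ln (2 * R) - ln (norm (z - p))) + (ln (2 * R) - ln (norm (w - p))))"
          using bl[OF p] by (intro mult_left_mono) auto
        finally show "real_of_int (zorder g p) * ?d \<le> ?a p * ((ln (2 * R) - ln (norm (z - p))) + (ln (2 * R) - ln (norm (w - p))))" .
      qed
      finally show ?thesis unfolding hz by simp
    qed
    ultimately show ?thesis using not_bad_nonzero[OF nb(1)] not_bad_nonzero[OF nb(2)]
      unfolding w_def[symmetric] by (simp add: log_plus_eq norm_divide ln_div)
  qed
  have ch: "continuous_on (sphere 0 r) h" unfolding h_def by (intro continuous_intros cont)
  have m1: "ln r \<le> circle_mean r (\<lambda>z. ln (norm (z - p)))" if p: "p \<in> ?P" for p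
  proof -
    have "norm p \<noteq> r" using p good_not_bad[OF r, of p] by auto
    then show ?thesis using r0 by (simp add: circle_mean_ln_norm)
  qed
  have m2: "ln (norm q * r) \<le> circle_mean r (\<lambda>z. ln (norm (q * z + (c - p))))" if p: "p \<in> ?P" for p
  proof -
    \<comment> \<open>Equality would put the preimage (p - c)/q of a bad point on the circle |z| =
      r, which \<open>img\<close> excludes.\<close>
    have "norm q * r \<noteq> norm (c - p)"
    proof
      assume eq: "norm q * r = norm (c - p)"
      have q0: "q \<noteq> 0" using q by auto
      have "norm ((p - c) / q) = r" using eq q0 by (simp add: norm_divide norm_minus_commute field_simps)
      then have "q * ((p - c) / q) + c \<notin> bad g" by (rule img)
      then show False using p q0 by simp
    qed
    then have "circle_mean r (\<lambda>z. ln (norm (q * z + (c - p)))) = ln (max (norm q * r) (norm (c - p)))"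
      using r0 by (intro circle_mean_ln_affine)
    moreover have "0 < norm q * r" using r0 q by simp
    ultimately show ?thesis by (simp only:) (rule ln_mono, simp_all)
  qed
  have "proximity r (\<lambda>z. g (q * z + c) / g z) \<le> circle_mean r h"
    using r0 ch le by (intro proximity_le_circle_mean) auto
  also have "circle_mean r h = A + (\<Sum>p\<in>?P. circle_mean r (\<lambda>z. ?a p *
     ((ln (2 * R) - ln (norm (z - p))) + (ln (2 * R) - ln (norm (q * z + (c - p)))))))"
    unfolding h_def by (intro circle_mean_const_plus_sum continuous_intros cont less_imp_le[OF r0])
  also have "\<dots> \<le> A + (\<Sum>p\<in>?P. ?a p * (2 * ln (2 * R) - ln (norm q * r) - ln r))"
  proof (intro add_left_mono sum_mono)
    fix p assume p: "p \<in> ?P"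
    have "circle_mean r (\<lambda>z. (ln (2 * R) - ln (norm (z - p))) + (ln (2 * R) - ln (norm (q * z + (c - p)))))
       = circle_mean r (\<lambda>z. (2 * ln (2 * R) - ln (norm (z - p))) - ln (norm (q * z + (c - p))))"
      by (simp add: algebra_simps)
    also have "\<dots> = 2 * ln (2 * R) - circle_mean r (\<lambda>z. ln (norm (z - p))) - circle_mean r (\<lambda>z. ln (norm (q * z + (c - p))))"
      by (simp only: circle_mean_diff circle_mean_const cont[OF p] continuous_on_diff
          continuous_on_const less_imp_le[OF r0])
    also have "\<dots> \<le> 2 * ln (2 * R) - ln (norm q * r) - ln r" using m1[OF p] m2[OF p] by linarith
    finally show "circle_mean r (\<lambda>z. ?a p *
     ((ln (2 * R) - ln (norm (z - p))) + (ln (2 * R) - ln (norm (q * z + (c - p))))))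
      \<le> ?a p * (2 * ln (2 * R) - ln (norm q * r) - ln r)"
      unfolding circle_mean_cmult by (intro mult_left_mono) auto
  qed
  finally show ?thesis unfolding A_def sum_distrib_right .
qed

text \<open>Ingredient of a Liouville argument: without zeros and poles the Blaschke product is 1,
  and if T stays bounded, the exponent u tends to 0 as R grows.\<close>

lemma zero_free_exp_quotient:
  assumes R: "good_radius g R" and z: "norm z \<le> r" "norm w \<le> r" "2 * r \<le> R" "z \<notin> bad g" "w \<notin> bad g"
    and 0: "\<And>p. p \<in> bad g \<inter> ball 0 R \<Longrightarrow> zorder g p = 0"
  shows "\<exists>u. g z = g w * exp u \<and> norm u \<le> 8 * r / R * (proximity R g + proximity R (\<lambda>z. 1 / g z))"
proof -
  obtain H where H: "is_schwarz_log R H" using schwarz_log_exists[OF R] by blast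
  have *: "g z = exp (H z)" if "norm z \<le> r" "z \<notin> bad g" for z
  proof -
    have "norm z \<le> R" using that z(3) norm_ge_zero[of z] by linarith
    then show ?thesis using H that 0 by (simp add: is_schwarz_log_def)
  qed
  have "g z = g w * exp (H z - H w)" using *[of z] *[of w] z by (simp add: exp_diff)
  then show ?thesis using schwarz_log_diff[OF H R z(1,2,3)] by blast
qed

end

section \<open>Agreement of \<open>nev\<close> with the characteristic\<close>

lemma has_integral_inverse_ln:
  fixes a b :: real
  assumes "0 < a" "a \<le> b"
  shows "((\<lambda>t. 1 / t) has_integral (ln b - ln a)) {a..b}"
proof (rule fundamental_theorem_of_calculus[OF assms(2)])
  fix x assume "x \<in> {a..b}"
  then have "(ln has_real_derivative 1 / x) (at x within {a..b})"
    using assms by (auto intro!: derivative_eq_intros)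
  then show "(ln has_vector_derivative 1 / x) (at x within {a..b})"
    by (simp add: has_real_derivative_iff_has_vector_derivative)
qed

context nonzero_meromorphic
begin

text \<open>An index set independent of t allows the integral in \<open>pole_counting\<close> to be
  taken termwise; bad points that are not poles have weight 0.\<close>

lemma pole_count_eq:
  assumes R: "good_radius g R" and t: "t \<le> R"
  shows "pole_count t g = (\<Sum>p\<in>bad g \<inter> ball 0 R. if norm p \<le> t then pole_weight (zorder g p) else 0)"
proof -
  have "(\<Sum>z | norm z \<le> t \<and> is_pole g z. real_of_int (- zorder g z))
     = (\<Sum>p\<in>bad g \<inter> ball 0 R. if norm p \<le> t \<and> is_pole g p then real_of_int (- zorder g p) else 0)"
  proof (intro sum.mono_neutral_cong_left)
    show "{z. norm z \<le> t \<and> is_pole g z} \<subseteq> bad g \<inter> ball 0 R"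
    proof safe
      fix z assume z: "norm z \<le> t" "is_pole g z"
      then show b: "z \<in> bad g" using analytic_at_imp_no_pole by (auto simp: bad_def)
      then have "norm z \<noteq> R" using good_not_bad[OF R] by blast
      then show "z \<in> ball 0 R" using z t by auto
    qed
  qed auto
  also have "\<dots> = (\<Sum>p\<in>bad g \<inter> ball 0 R. if norm p \<le> t then pole_weight (zorder g p) else 0)"
    by (intro sum.cong refl) (auto simp: pole_iff pole_weight_def)
  finally show ?thesis unfolding pole_count_def .
qed

text \<open>A pole p off the origin contributes its multiplicity times the integral of 1/t over
  [|p|, R]. A pole at 0 is removed from the integrand by subtracting \<open>pole_count 0 g\<close>
  and returns through the term with ln R.\<close>

lemma pole_counting_eq:
  assumes R: "good_radius g R"
  shows "pole_counting R g = point_counting R pole_weight"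
proof -
  let ?P = "bad g \<inter> ball 0 R"
  let ?w = "\<lambda>p. pole_weight (zorder g p)"
  have R0: "R > 0" using good_pos[OF R] .
  have c0: "pole_count 0 g = (\<Sum>p\<in>?P. if p = 0 then ?w p else 0)"
    using pole_count_eq[OF R, of 0] R0 by simp
  have "((\<lambda>t. \<Sum>p\<in>?P. ?w p * (if p = 0 then 0 else if t \<in> {norm p..R} then 1 / t else 0))
      has_integral (\<Sum>p\<in>?P. ?w p * (if p = 0 then 0 else ln R - ln (norm p)))) {0..R}"
  proof (intro has_integral_sum has_integral_mult_right)
    fix p assume p: "p \<in> ?P"
    show "((\<lambda>t. if p = 0 then 0 else if t \<in> {norm p..R} then 1 / t else 0) has_integral
        (if p = 0 then 0 else ln R - ln (norm p))) {0..R}"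
    proof (cases "p = 0")
      case False
      then have "((\<lambda>t. if t \<in> {norm p..R} then 1 / t else 0) has_integral (ln R - ln (norm p))) {0..R}"
        using p has_integral_inverse_ln[of "norm p" R]
        by (subst has_integral_restrict) auto
      then show ?thesis using False by simp
    qed auto
  qed simp
  then have "((\<lambda>t. (pole_count t g - pole_count 0 g) / t)
      has_integral (\<Sum>p\<in>?P. ?w p * (if p = 0 then 0 else ln R - ln (norm p)))) {0..R}"
  proof (rule has_integral_eq[rotated])
    fix t assume t: "t \<in> {0..R}"
    then have "(pole_count t g - pole_count 0 g) / t =
       (\<Sum>p\<in>?P. ((if norm p \<le> t then ?w p else 0) - (if p = 0 then ?w p else 0)) / t)"
      using pole_count_eq[OF R, of t] unfolding c0 sum_divide_distrib[symmetric] sum_subtractf by simp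
    also have "\<dots> = (\<Sum>p\<in>?P. ?w p * (if p = 0 then 0 else if t \<in> {norm p..R} then 1 / t else 0))"
      using t by (intro sum.cong refl) auto
    finally show "(\<Sum>p\<in>?P. ?w p * (if p = 0 then 0 else if t \<in> {norm p..R} then 1 / t else 0))
      = (pole_count t g - pole_count 0 g) / t" ..
  qed
  then have "pole_counting R g = (\<Sum>p\<in>?P. ?w p * (if p = 0 then 0 else ln R - ln (norm p))) + pole_count 0 g * ln R"
    unfolding pole_counting_def by (simp add: integral_unique)
  also have "\<dots> = point_counting R pole_weight"
    unfolding c0 point_counting_def sum_distrib_right sum.distrib[symmetric]
    by (intro sum.cong refl) auto
  finally show ?thesis .
qed

lemma characteristic_eq_nev:
  "good_radius g R \<Longrightarrow> characteristic R g = nev R"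
  by (simp add: characteristic_def nev_def pole_counting_eq)

end

section \<open>Density of indices and radii\<close>

text \<open>A Chebyshev-type count: each exceptional j < m contributes at least d to the sum of u(j
  + n) - u(j), and this sum telescopes, one unit shift at a time, to at most n u(m + n) =
  o(m).\<close>

lemma sparse_doubling_indices:
  fixes u :: "nat \<Rightarrow> real"
  assumes mono: "mono u" and nonneg: "\<And>n. 0 \<le> u n" and lim: "(\<lambda>n. u n / real n) \<longlonglongrightarrow> 0" and d: "0 < d"
  shows "(\<lambda>m. card ({j. u (j + n) > u j + d} \<inter> {..<m}) / real m) \<longlonglongrightarrow> 0"
proof (rule tendsto_sandwich[OF _ _ tendsto_const])
  have bound: "d * card ({j. u (j + n) > u j + d} \<inter> {..<m}) \<le> n * u (m + n)" for m
  proof -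
    have "(\<Sum>j<m. u (j + n) - u j) \<le> n * u (m + n)"
    proof (induction n)
      case (Suc n)
      have "(\<Sum>j<m. u (j + Suc n) - u j) = (\<Sum>j<m. u (j + n) - u j) + (\<Sum>j<m. u (Suc j + n) - u (j + n))"
        by (simp add: sum.distrib[symmetric])
      also have "(\<Sum>j<m. u (Suc j + n) - u (j + n)) = u (m + n) - u n"
        using sum_lessThan_telescope[of "\<lambda>j. u (j + n)" m] by simp
      also have "(\<Sum>j<m. u (j + n) - u j) + (u (m + n) - u n) \<le> real (Suc n) * u (m + n)"
        using Suc nonneg[of n] by (simp add: algebra_simps)
      also have "\<dots> \<le> real (Suc n) * u (m + Suc n)"
        using mono by (intro mult_left_mono) (auto simp: mono_def)
      finally show ?case .
    qed auto
    moreover have "d * card ({j. u (j + n) > u j + d} \<inter> {..<m}) = (\<Sum>j\<in>{j. u (j + n) > u j + d} \<inter> {..<m}. d)"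
      by simp
    moreover have "\<dots> \<le> (\<Sum>j\<in>{j. u (j + n) > u j + d} \<inter> {..<m}. u (j + n) - u j)"
      by (intro sum_mono) auto
    moreover have "\<dots> \<le> (\<Sum>j<m. u (j + n) - u j)"
      using mono by (intro sum_mono2) (auto simp: mono_def)
    ultimately show ?thesis by linarith
  qed
  show "\<forall>\<^sub>F m in sequentially. card ({j. u (j + n) > u j + d} \<inter> {..<m}) / real m
      \<le> n / d * (u (m + n) / real (m + n) * (real (m + n) / real m))"
    using eventually_gt_at_top[of 0]
  proof eventually_elim
    case (elim m)
    have "u (m + n) / real (m + n) * (real (m + n) / real m) = u (m + n) / real m"
      using elim by simp
    moreover have "card ({j. u (j + n) > u j + d} \<inter> {..<m}) \<le> n / d * u (m + n)"
      using bound[of m] d by (simp add: field_simps)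
    then have "card ({j. u (j + n) > u j + d} \<inter> {..<m}) / real m \<le> n / d * u (m + n) / real m"
      by (rule divide_right_mono) simp
    ultimately show ?case by (simp only: times_divide_eq_right)
  qed
  have "(\<lambda>m. u (m + n) / real (m + n)) \<longlonglongrightarrow> 0" by (rule LIMSEQ_ignore_initial_segment[OF lim])
  moreover have "(\<lambda>m. real (m + n) / real m) \<longlonglongrightarrow> 1" by real_asymp
  ultimately have "(\<lambda>m. n / d * (u (m + n) / real (m + n) * (real (m + n) / real m))) \<longlonglongrightarrow> n / d * (0 * 1)"
    by (intro tendsto_intros)
  then show "(\<lambda>m. n / d * (u (m + n) / real (m + n) * (real (m + n) / real m))) \<longlonglongrightarrow> 0" by simp
qed (auto intro!: always_eventually)

text \<open>Countably many increasing sets of density zero are, up to finitely many elements each,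
  contained in a single set of density zero: the \<open>n\<close>-th one is only used beyond \<open>M n\<close>.\<close>

lemma density_zero_diagonal:
  fixes B :: "nat \<Rightarrow> nat set"
  assumes inc: "\<And>i n. i \<le> n \<Longrightarrow> B i \<subseteq> B n"
    and dens: "\<And>n. (\<lambda>m. card (B n \<inter> {..<m}) / real m) \<longlonglongrightarrow> 0"
  obtains G where "(\<lambda>m. card (G \<inter> {..<m}) / real m) \<longlonglongrightarrow> 1"
    "\<And>n. \<forall>\<^sub>F j in sequentially. j \<in> G \<longrightarrow> j \<notin> B n"
proof -
  have "\<exists>M. \<forall>m\<ge>M. card (B n \<inter> {..<m}) / real m < 1 / real (Suc n)" for n
    using order_tendstoD(2)[OF dens[of n], of "1 / real (Suc n)"] by (simp add: eventually_sequentially)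
  then obtain f where f: "\<And>n m. m \<ge> f n \<Longrightarrow> card (B n \<inter> {..<m}) / real m < 1 / real (Suc n)"
    by metis
  \<comment> \<open>The summand n makes only finitely many M n lie below a given m, so the maximum
    taken below exists. M n >= f n makes the density bound for \<open>B n\<close> valid from M n
    on.\<close>
  define M where "M = (\<lambda>n. n + (\<Sum>i\<le>n. f i))"
  have Mn: "n \<le> M n" "f n \<le> M n" for n
    using member_le_sum[of n "{..n}" f] by (auto simp: M_def)
  define D where "D = {j. \<exists>n. M n \<le> j \<and> j \<in> B n}"
  have D0: "(\<lambda>m. card (D \<inter> {..<m}) / real m) \<longlonglongrightarrow> 0"
  proof (rule LIMSEQ_I)
    fix e :: real assume e: "e > 0"
    obtain N where N: "1 / real (Suc N) < e" using e nat_approx_posE by blast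
    show "\<exists>no. \<forall>m\<ge>no. norm (card (D \<inter> {..<m}) / real m - 0) < e"
    proof (intro exI allI impI)
      fix m assume m: "m \<ge> M N"
      define n where "n = Max {n. M n \<le> m}"
      have fin: "finite {n. M n \<le> m}"
      proof (rule finite_subset)
        show "{n. M n \<le> m} \<subseteq> {..m}"
        proof
          fix i assume "i \<in> {n. M n \<le> m}"
          then show "i \<in> {..m}" using Mn(1)[of i] by simp
        qed
      qed simp
      have n: "M n \<le> m" "N \<le> n" using Max_in[OF fin] Max_ge[OF fin, of N] m by (auto simp: n_def)
      \<comment> \<open>Every set used below m has index at most n, and the sets increase, so the
        single set \<open>B n\<close> covers D there.\<close>
      have "D \<inter> {..<m} \<subseteq> B n \<inter> {..<m}"
      proof safe
        fix j assume j: "j \<in> D" "j < m"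
        then obtain i where i: "M i \<le> j" "j \<in> B i" by (auto simp: D_def)
        then have "i \<le> n" using Max_ge[OF fin, of i] j by (auto simp: n_def)
        then show "j \<in> B n" using inc i by blast
      qed
      then have "card (D \<inter> {..<m}) / real m \<le> card (B n \<inter> {..<m}) / real m"
        by (intro divide_right_mono) (auto intro!: card_mono)
      also have "\<dots> < 1 / real (Suc n)" using n Mn(2)[of n] by (intro f) auto
      also have "\<dots> \<le> 1 / real (Suc N)" using n by (intro divide_left_mono) auto
      finally show "norm (card (D \<inter> {..<m}) / real m - 0) < e" using N by simp
    qed
  qed
  show thesis
  proof (rule that[of "- D"])
    have "(\<lambda>m. 1 - card (D \<inter> {..<m}) / real m) \<longlonglongrightarrow> 1 - 0" by (intro tendsto_intros D0)
    moreover have "\<forall>\<^sub>F m in sequentially. 1 - card (D \<inter> {..<m}) / real m = card (- D \<inter> {..<m}) / real m"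
      using eventually_gt_at_top[of 0]
    proof eventually_elim
      case (elim m)
      have "card (- D \<inter> {..<m}) = card ({..<m} - D \<inter> {..<m})" by (rule arg_cong[where f = card]) auto
      also have "\<dots> = m - card (D \<inter> {..<m})" by (subst card_Diff_subset) auto
      finally have "real (card (- D \<inter> {..<m})) = real m - card (D \<inter> {..<m})"
        using card_mono[of "{..<m}" "D \<inter> {..<m}"] by (simp add: of_nat_diff)
      then show ?case using elim by (simp add: field_simps)
    qed
    ultimately show "(\<lambda>m. card (- D \<inter> {..<m}) / real m) \<longlonglongrightarrow> 1"
      unfolding diff_zero by (rule Lim_transform_eventually)
    show "\<forall>\<^sub>F j in sequentially. j \<in> - D \<longrightarrow> j \<notin> B n" for n
      using eventually_ge_at_top[of "M n"] by eventually_elim (auto simp: D_def)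
  qed
qed

text \<open>Each interval has logarithmic measure exactly 1, so the logarithmic measure of the union
  up to r is, up to a bounded error, the number of indices of G below ln r. The countable set C is
  null.\<close>

lemma has_log_density_one_intervals:
  assumes G: "(\<lambda>m. card (G \<inter> {..<m}) / real m) \<longlonglongrightarrow> 1" and C: "countable C"
  shows "has_log_density_one ((\<Union>j\<in>G. {exp (real j + 1)..<exp (real j + 2)}) - C)"
proof -
  define E where "E = (\<Union>j\<in>G. {exp (real j + 1)..<exp (real j + 2)}) - C"
  have E1: "E \<subseteq> {1..}"
  proof
    fix x assume "x \<in> E"
    then obtain j where "exp (real j + 1) \<le> x" by (auto simp: E_def)
    then have "1 \<le> x" by (rule order_trans[rotated]) simp
    then show "x \<in> {1..}" by simp
  qed
  have "C \<in> sets borel" by (rule sets.countable[OF _ C], rule borel_closed, rule closed_singleton)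
  then have E2: "E \<in> sets borel"
    unfolding E_def by (intro sets.Diff sets.countable_UN') (simp_all add: image_subset_iff)
  then have E3: "E \<in> sets lebesgue" by (simp add: sets_completionI_sets)
  have ub: "integral (E \<inter> {1..r}) (\<lambda>t. 1 / t) \<le> ln r"
    and lb: "card (G \<inter> {..<nat \<lfloor>ln r\<rfloor> - 1}) \<le> integral (E \<inter> {1..r}) (\<lambda>t. 1 / t)" if r: "r \<ge> 1" for r
  proof -
    have I: "((\<lambda>t. 1 / t) has_integral ln r) {1..r}" using has_integral_inverse_ln[of 1 r] r by simp
    have "(\<lambda>t::real. 1 / t) absolutely_integrable_on {1..r}"
      using I by (intro nonnegative_absolutely_integrable_1) auto
    then have "(\<lambda>t::real. 1 / t) absolutely_integrable_on E \<inter> {1..r}"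
      by (rule set_integrable_subset) (use E3 in \<open>simp_all add: sets.Int\<close>)
    then have IE: "(\<lambda>t. 1 / t) integrable_on E \<inter> {1..r}"
      by (rule set_lebesgue_integral_eq_integral)
    show "integral (E \<inter> {1..r}) (\<lambda>t. 1 / t) \<le> ln r"
      using integral_subset_le[OF _ IE has_integral_integrable[OF I]] integral_unique[OF I] by auto
    \<comment> \<open>Indices j < m are those with j + 2 <= ln r, whose whole interval lies below r;
      truncated subtraction covers small r.\<close>
    define m where "m = nat \<lfloor>ln r\<rfloor> - 1"
    have mr: "exp (real j + 2) \<le> r" if "j < m" for j
    proof -
      have "real j + 2 \<le> ln r" using that unfolding m_def by linarith
      then show ?thesis using r by (simp add: ln_ge_iff)
    qed
    \<comment> \<open>Closed intervals exceed the half-open ones by a countable set only and overlap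
      at most in endpoints, and their integrals are directly available.\<close>
    let ?D = "\<Union>j\<in>G \<inter> {..<m}. {exp (real j + 1)..exp (real j + 2)}"
    have D: "((\<lambda>t. 1 / t) has_integral (\<Sum>j\<in>G \<inter> {..<m}. 1)) ?D"
    proof (rule has_integral_UN)
      fix j assume "j \<in> G \<inter> {..<m}"
      show "((\<lambda>t. 1 / t) has_integral 1) {exp (real j + 1)..exp (real j + 2)}"
        using has_integral_inverse_ln[of "exp (real j + 1)" "exp (real j + 2)"] by simp
    next
      show "pairwise (\<lambda>i i'. negligible ({exp (real i + 1)..exp (real i + 2)} \<inter> {exp (real i' + 1)..exp (real i' + 2)})) (G \<inter> {..<m})"
      proof (intro pairwiseI)
        fix i j :: nat assume "i \<noteq> j"
        have "{exp (real i + 1)..exp (real i + 2)} \<inter> {exp (real j + 1)..exp (real j + 2)} \<subseteq> {exp (real i + 2), exp (real j + 2)}"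
        proof (cases "i < j")
          case True
          then have "exp (real i + 2) \<le> exp (real j + 1)" by simp
          then have "x = exp (real i + 2)" if "exp (real j + 1) \<le> x" "x \<le> exp (real i + 2)" for x
            using that by (meson order.antisym order.trans)
          then show ?thesis by auto
        next
          case False
          then have "exp (real j + 2) \<le> exp (real i + 1)" using \<open>i \<noteq> j\<close> by simp
          then have "x = exp (real j + 2)" if "exp (real i + 1) \<le> x" "x \<le> exp (real j + 2)" for x
            using that by (meson order.antisym order.trans)
          then show ?thesis by auto
        qed
        then show "negligible ({exp (real i + 1)..exp (real i + 2)} \<inter> {exp (real j + 1)..exp (real j + 2)})"
          by (rule negligible_subset[rotated]) (auto intro: negligible_finite)
      qed
    qed simp
    have neg: "negligible (C \<union> range (\<lambda>j. exp (real j + 2)))"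
      unfolding negligible_iff_null_sets using C
      by (intro null_sets_completionI countable_imp_null_set_lborel) auto
    have sub: "?D - E \<inter> {1..r} \<subseteq> C \<union> range (\<lambda>j. exp (real j + 2))"
    proof
      fix x assume x: "x \<in> ?D - E \<inter> {1..r}"
      then obtain j where j: "j \<in> G" "j < m" "exp (real j + 1) \<le> x" "x \<le> exp (real j + 2)" by auto
      have "1 \<le> x" using j(3) by (rule order_trans[rotated]) simp
      moreover have "x \<le> r" using j mr[of j] by linarith
      ultimately have "x \<notin> E" using x by auto
      then show "x \<in> C \<union> range (\<lambda>j. exp (real j + 2))" using j by (force simp: E_def)
    qed
    have neg1: "negligible {x \<in> E \<inter> {1..r} - (?D \<union> E \<inter> {1..r}). 1 / x \<noteq> 0}"
      by (rule negligible_subset[OF negligible_empty]) blast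
    have neg2: "negligible {x \<in> (?D \<union> E \<inter> {1..r}) - E \<inter> {1..r}. 1 / x \<noteq> 0}"
      by (rule negligible_subset[OF negligible_subset[OF neg sub]]) blast
    \<comment> \<open>Adding ?D changes the domain only by a null set, so the integral is
      unaffected; now the integral over ?D can be compared by inclusion.\<close>
    have DE: "((\<lambda>t. 1 / t) has_integral integral (E \<inter> {1..r}) (\<lambda>t. 1 / t)) (?D \<union> E \<inter> {1..r})"
      using integrable_integral[OF IE] has_integral_spike_set_eq[OF neg1 neg2] by blast
    have "\<forall>x\<in>?D \<union> E \<inter> {1..r}. 0 \<le> 1 / x"
    proof
      fix x assume x: "x \<in> ?D \<union> E \<inter> {1..r}"
      have "0 \<le> x" if "exp (real j + 1) \<le> x" for j
        using that exp_ge_zero order.trans by blast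
      then show "0 \<le> 1 / x" using x by auto
    qed
    then have "(\<Sum>j\<in>G \<inter> {..<m}. 1) \<le> integral (E \<inter> {1..r}) (\<lambda>t. 1 / t)"
      by (intro has_integral_subset_le[OF _ D DE]) auto
    then show "card (G \<inter> {..<nat \<lfloor>ln r\<rfloor> - 1}) \<le> integral (E \<inter> {1..r}) (\<lambda>t. 1 / t)"
      by (simp add: m_def)
  qed
  have "((\<lambda>r. 1 / ln r * integral (E \<inter> {1..r}) (\<lambda>t. 1 / t)) \<longlongrightarrow> 1) at_top"
  proof (rule tendsto_sandwich[OF _ _ _ tendsto_const])
    let ?m = "\<lambda>r::real. nat \<lfloor>ln r\<rfloor> - 1"
    show "\<forall>\<^sub>F r in at_top. 1 / ln r * integral (E \<inter> {1..r}) (\<lambda>t. 1 / t) \<le> 1"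
      using eventually_gt_at_top[of 1] by eventually_elim (use ub in \<open>simp add: field_simps\<close>)
    show "\<forall>\<^sub>F r in at_top. card (G \<inter> {..<?m r}) / real (?m r) * (real (?m r) / ln r) \<le> 1 / ln r * integral (E \<inter> {1..r}) (\<lambda>t. 1 / t)"
      using eventually_gt_at_top[of "exp 3"]
    proof eventually_elim
      case (elim r)
      have "1 < exp (3::real)" by simp
      then have r1: "r > 1" using elim by linarith
      have "card (G \<inter> {..<?m r}) / real (?m r) * (real (?m r) / ln r) \<le> card (G \<inter> {..<?m r}) / ln r"
        using r1 by (cases "?m r = 0") auto
      also have "\<dots> \<le> 1 / ln r * integral (E \<inter> {1..r}) (\<lambda>t. 1 / t)"
        using lb[of r] r1 by (simp add: divide_right_mono)
      finally show ?case .
    qed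
    have "filterlim ?m at_top at_top"
      unfolding filterlim_at_top
    proof
      fix Z :: nat
      show "\<forall>\<^sub>F r in at_top. Z \<le> ?m r"
        using eventually_ge_at_top[of "exp (real Z + 2)"]
      proof eventually_elim
        case (elim r)
        have "r > 0" using elim exp_gt_zero[of "real Z + 2"] by linarith
        then have "real Z + 2 \<le> ln r" using elim by (simp add: ln_ge_iff)
        then show ?case by linarith
      qed
    qed
    then have "((\<lambda>r. card (G \<inter> {..<?m r}) / real (?m r)) \<longlongrightarrow> 1) at_top"
      by (rule filterlim_compose[OF G])
    moreover have "((\<lambda>r. real (?m r) / ln r) \<longlongrightarrow> 1) at_top"
    proof (rule tendsto_sandwich[OF _ _ _ tendsto_const])
      show "((\<lambda>r::real. (ln r - 2) / ln r) \<longlongrightarrow> 1) at_top" by real_asymp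
      show "\<forall>\<^sub>F r in at_top. (ln r - 2) / ln r \<le> real (?m r) / ln r"
        using eventually_gt_at_top[of 1]
      proof eventually_elim
        case (elim r)
        have "ln r - 2 \<le> real (?m r)" by linarith
        then show ?case using elim by (intro divide_right_mono) auto
      qed
      show "\<forall>\<^sub>F r in at_top. real (?m r) / ln r \<le> 1"
        using eventually_gt_at_top[of 1]
      proof eventually_elim
        case (elim r)
        then have l: "ln r > 0" by simp
        then have "real (?m r) \<le> ln r" by linarith
        then show ?case using l by (simp add: field_simps)
      qed
    qed
    ultimately have "((\<lambda>r. card (G \<inter> {..<?m r}) / real (?m r) * (real (?m r) / ln r)) \<longlongrightarrow> 1 * 1) at_top"
      by (rule tendsto_mult)
    then show "((\<lambda>r. card (G \<inter> {..<?m r}) / real (?m r) * (real (?m r) / ln r)) \<longlongrightarrow> 1) at_top" by simp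
  qed
  then show ?thesis unfolding has_log_density_one_def E_def[symmetric]
    using E1 E3 by auto
qed

section \<open>Hahn differences\<close>

text \<open>The coefficients do not depend on g. Far out, a further difference subtracts two
  coefficients of modulus at most 1 and divides by a number of modulus at least 2, so the bound 1
  reproduces itself. At the zero of the denominator both sides of the inductive step are 0 by the
  convention for division.\<close>

lemma hahn_diff_iterate:
  assumes q: "0 < norm q" "norm q < 1"
  shows "\<exists>a X. \<forall>z. (\<forall>g. (hahn_diff q c ^^ k) g z = (\<Sum>j\<le>k. a j z * g (((\<lambda>z. q * z + c) ^^ j) z))) \<and>
     (X \<le> norm z \<longrightarrow> (\<forall>j\<le>k. norm (a j z) \<le> 1))"
proof (induction k)
  case 0
  show ?case by (rule exI[of _ "\<lambda>_ _. 1"]) auto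
next
  case (Suc k)
  let ?f = "\<lambda>z. q * z + c"
  obtain a X where aX: "\<forall>z. (\<forall>g. (hahn_diff q c ^^ k) g z = (\<Sum>j\<le>k. a j z * g ((?f ^^ j) z))) \<and>
     (X \<le> norm z \<longrightarrow> (\<forall>j\<le>k. norm (a j z) \<le> 1))"
    using Suc by blast
  then have a: "(hahn_diff q c ^^ k) g z = (\<Sum>j\<le>k. a j z * g ((?f ^^ j) z))" for z g
    by blast
  have X: "norm (a j z) \<le> 1" if "X \<le> norm z" "j \<le> k" for z j
    using aX that by blast
  define d where "d = (\<lambda>z. (q - 1) * z + c)"
  define b where "b = (\<lambda>j z. ((if j = 0 then 0 else a (j - 1) (?f z)) - (if j \<le> k then a j z else 0)) / d z)"
  \<comment> \<open>The three summands guarantee, in turn, X <= |z|, |d z| >= 2 and X <= |q z +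
    c|.\<close>
  define Y where "Y = \<bar>X\<bar> + (2 + norm c) / norm (q - 1) + (\<bar>X\<bar> + norm c) / norm q"
  have "q \<noteq> 1" using q by auto
  show ?case
  proof (intro exI[of _ b] exI[of _ Y] allI conjI impI)
    fix z g
    have "(\<Sum>j\<le>Suc k. b j z * g ((?f ^^ j) z)) =
      ((\<Sum>j\<le>Suc k. (if j = 0 then 0 else a (j - 1) (?f z)) * g ((?f ^^ j) z))
       - (\<Sum>j\<le>Suc k. (if j \<le> k then a j z else 0) * g ((?f ^^ j) z))) / d z"
      unfolding b_def sum_subtractf[symmetric] sum_divide_distrib
      by (intro sum.cong refl) (simp add: left_diff_distrib diff_divide_distrib)
    also have "(\<Sum>j\<le>Suc k. (if j = 0 then 0 else a (j - 1) (?f z)) * g ((?f ^^ j) z))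
       = (\<Sum>j\<le>k. a j (?f z) * g ((?f ^^ j) (?f z)))"
      by (subst sum.atMost_Suc_shift) (simp add: funpow_Suc_right del: funpow.simps)
    also have "(\<Sum>j\<le>Suc k. (if j \<le> k then a j z else 0) * g ((?f ^^ j) z)) = (\<Sum>j\<le>k. a j z * g ((?f ^^ j) z))"
      by simp
    finally show "(hahn_diff q c ^^ Suc k) g z = (\<Sum>j\<le>Suc k. b j z * g ((?f ^^ j) z))"
      by (simp add: a[symmetric] hahn_diff_def d_def)
  next
    fix z :: complex and j assume z: "Y \<le> norm z" and j: "j \<le> Suc k"
    have nn: "0 \<le> \<bar>X\<bar>" "0 \<le> (2 + norm c) / norm (q - 1)" "0 \<le> (\<bar>X\<bar> + norm c) / norm q" by auto
    have 1: "X \<le> norm z" using z nn unfolding Y_def by linarith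
    have "(2 + norm c) / norm (q - 1) \<le> norm z" using z nn unfolding Y_def by linarith
    then have "2 + norm c \<le> norm ((q - 1) * z)"
      using \<open>q \<noteq> 1\<close> by (simp only: norm_mult) (simp add: field_simps)
    then have 2: "2 \<le> norm (d z)" using norm_diff_ineq[of "(q - 1) * z" c] unfolding d_def by linarith
    have "(\<bar>X\<bar> + norm c) / norm q \<le> norm z" using z nn unfolding Y_def by linarith
    then have "\<bar>X\<bar> + norm c \<le> norm (q * z)"
      using q by (simp add: norm_mult field_simps)
    then have 3: "X \<le> norm (?f z)" using norm_diff_ineq[of "q * z" c] by linarith
    have "norm (if j = 0 then 0 else a (j - 1) (?f z)) \<le> 1" using X[OF 3] j by auto
    moreover have "norm (if j \<le> k then a j z else 0) \<le> 1" using X[OF 1] by auto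
    ultimately have "norm ((if j = 0 then 0 else a (j - 1) (?f z)) - (if j \<le> k then a j z else 0)) \<le> 2"
      using norm_triangle_ineq4[of "if j = 0 then 0 else a (j - 1) (?f z)" "if j \<le> k then a j z else 0"]
      by linarith
    then have "norm (b j z) \<le> 2 / 2"
      using 2 unfolding b_def norm_divide by (intro frac_le) auto
    then show "norm (b j z) \<le> 1" by simp
  qed
qed

lemma affine_iterate:
  "((\<lambda>z. q * z + c) ^^ j) z = q ^ j * z + ((\<lambda>z. q * z + c) ^^ j) (0::complex)"
  by (induction j) (auto simp: algebra_simps)

text \<open>A map sending the disc |z| <= r into itself has iterates doing the same; this supplies
  the shift hypothesis of \<open>proximity_shift_quotient\<close> with q^j in place of q.\<close>

lemma norm_affine_iterate:
  fixes q c :: complex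
  assumes "norm q * r + norm c \<le> r"
  shows "norm q ^ j * r + norm (((\<lambda>z. q * z + c) ^^ j) 0) \<le> r"
proof (induction j)
  case (Suc j)
  have "norm (((\<lambda>z. q * z + c) ^^ Suc j) 0) \<le> norm q * norm (((\<lambda>z. q * z + c) ^^ j) 0) + norm c"
    by (simp add: order_trans[OF norm_triangle_ineq] norm_mult)
  then have "norm q ^ Suc j * r + norm (((\<lambda>z. q * z + c) ^^ Suc j) 0)
      \<le> norm q * (norm q ^ j * r + norm (((\<lambda>z. q * z + c) ^^ j) 0)) + norm c"
    by (simp add: algebra_simps)
  also have "\<dots> \<le> norm q * r + norm c"
    using Suc by (intro add_right_mono mult_left_mono) auto
  finally show ?case using assms by linarith
qed auto

text \<open>The sum is at most k + 1 times the product of all max 1 (x j), and the logarithm of that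
  product is the sum of the \<open>log_plus\<close> terms.\<close>

lemma log_plus_sum_le:
  fixes x :: "nat \<Rightarrow> real"
  assumes "\<And>j. j \<le> k \<Longrightarrow> 0 \<le> x j"
  shows "log_plus (\<Sum>j\<le>k. x j) \<le> ln (real (Suc k)) + (\<Sum>j\<le>k. log_plus (x j))"
proof -
  let ?Q = "\<Prod>j\<le>k. max 1 (x j)"
  have Q1: "1 \<le> ?Q" by (intro prod_ge_1) auto
  have "x j \<le> ?Q" if "j \<le> k" for j
  proof -
    have "?Q = max 1 (x j) * (\<Prod>j\<in>{..k} - {j}. max 1 (x j))"
      using that by (subst prod.remove[of _ j]) auto
    moreover have "1 \<le> (\<Prod>j\<in>{..k} - {j}. max 1 (x j))" by (intro prod_ge_1) auto
    then have "max 1 (x j) * 1 \<le> max 1 (x j) * (\<Prod>j\<in>{..k} - {j}. max 1 (x j))"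
      by (intro mult_left_mono) auto
    ultimately show ?thesis by simp
  qed
  then have "(\<Sum>j\<le>k. x j) \<le> real (Suc k) * ?Q"
    using sum_bounded_above[of "{..k}" x ?Q] by simp
  moreover have "1 * 1 \<le> real (Suc k) * ?Q" using Q1 by (intro mult_mono) auto
  ultimately have "ln (max 1 (\<Sum>j\<le>k. x j)) \<le> ln (real (Suc k) * ?Q)"
    by (intro ln_mono) auto
  also have "\<dots> = ln (real (Suc k)) + ln ?Q" using Q1 by (subst ln_mult) auto
  also have "ln ?Q = (\<Sum>j\<le>k. ln (max 1 (x j)))" by (intro ln_prod) auto
  finally show ?thesis by (simp add: log_plus_def)
qed

section \<open>Unboundedness of the characteristic, and the estimate at one radius\<close>

context nonzero_meromorphic
begin

text \<open>A single zero or pole would make T grow at least like a multiple of ln R by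
  \<open>multiplicity_bound\<close>, so all orders vanish. Then
  \<open>zero_free_exp_quotient\<close> with R tending to infinity gives g(z) = g(w). The
  contrapositive allows additive constants to be absorbed into o(T).\<close>

lemma nev_bounded_imp_constant:
  assumes good: "\<And>i. good_radius g (\<rho> i)" and big: "\<And>i. exp (real i) < \<rho> i"
    and bd: "\<And>i. nev (\<rho> i) \<le> K"
  shows "\<exists>a. \<forall>\<^sub>\<approx>z\<in>UNIV. g z = a"
proof -
  define M where "M = 2 * K + nev_const"
  have rho1: "1 \<le> \<rho> i" for i
    using big[of i] one_le_exp_iff[of "real i"] by linarith
  have lnrho: "real i < ln (\<rho> i)" for i
    using big[of i] rho1[of i] by (metis exp_gt_zero ln_exp ln_less_cancel_iff order.strict_trans)
  have ninf: "filterlim \<rho> at_top sequentially"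
  proof (rule filterlim_at_top_mono)
    show "filterlim (\<lambda>i. exp (real i)) at_top sequentially" by real_asymp
    show "\<forall>\<^sub>F i in sequentially. exp (real i) \<le> \<rho> i"
      using big less_imp_le by (intro always_eventually) blast
  qed
  have zo: "zorder g p = 0" for p
  proof (cases "p \<in> bad g")
    case False
    then show ?thesis by (rule not_bad_zorder)
  next
    case True
    obtain i where i: "norm p < \<rho> i"
      using ninf unfolding filterlim_at_top_dense eventually_sequentially by blast
    show ?thesis
    proof (rule ccontr)
      assume nz: "zorder g p \<noteq> 0"
      let ?S = "\<Sum>p\<in>bad g \<inter> ball 0 (\<rho> i). \<bar>real_of_int (zorder g p)\<bar>"
      have "\<bar>real_of_int (zorder g p)\<bar> \<le> ?S"
        using True i by (intro member_le_sum) auto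
      moreover have "1 \<le> \<bar>real_of_int (zorder g p)\<bar>" using nz by linarith
      ultimately have S: "1 \<le> ?S" by linarith
      \<comment> \<open>Far enough out for ln \<rho> l - ln \<rho> i to exceed the supposed bound
        M.\<close>
      obtain l :: nat where l: "real l > ln (\<rho> i) + \<bar>M\<bar>" using reals_Archimedean2 by blast
      then have d: "\<bar>M\<bar> < ln (\<rho> l) - ln (\<rho> i)" using lnrho[of l] by linarith
      then have "ln (\<rho> i) \<le> ln (\<rho> l)" by linarith
      then have le: "\<rho> i \<le> \<rho> l" using rho1[of i] rho1[of l] by (subst (asm) ln_le_cancel_iff) auto
      have "1 * (ln (\<rho> l) - ln (\<rho> i)) \<le> ?S * (ln (\<rho> l) - ln (\<rho> i))"
        using S d by (intro mult_right_mono) auto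
      also have "\<dots> \<le> 2 * nev (\<rho> l) + nev_const"
        by (intro multiplicity_bound good rho1 le)
      also have "\<dots> \<le> M" using bd[of l] by (simp add: M_def)
      finally have "ln (\<rho> l) - ln (\<rho> i) \<le> M" by simp
      then show False using d by linarith
    qed
  qed
  have const: "g z = g w" if z: "z \<notin> bad g" "w \<notin> bad g" for z w
  proof -
    define r where "r = max (norm z) (norm w)"
    have "\<forall>\<^sub>F l in sequentially. \<exists>u. g z = g w * exp u \<and> norm u \<le> 8 * r / \<rho> l * M"
      using filterlim_at_top[THEN iffD1, OF ninf, rule_format, of "2 * r"]
    proof eventually_elim
      case (elim l)
      obtain u where u: "g z = g w * exp u"
          "norm u \<le> 8 * r / \<rho> l * (proximity (\<rho> l) g + proximity (\<rho> l) (\<lambda>z. 1 / g z))"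
        using zero_free_exp_quotient[OF good[of l], of z r w] z zo elim by (auto simp: r_def)
      have "proximity (\<rho> l) g + proximity (\<rho> l) (\<lambda>z. 1 / g z) \<le> M"
        using nev_bounds(2)[OF good rho1, of l] bd[of l] unfolding M_def by linarith
      then have "8 * r / \<rho> l * (proximity (\<rho> l) g + proximity (\<rho> l) (\<lambda>z. 1 / g z)) \<le> 8 * r / \<rho> l * M"
        using rho1[of l] by (intro mult_left_mono divide_nonneg_nonneg) (auto simp: r_def le_max_iff_disj)
      then show ?case using u by (intro exI[of _ u]) auto
    qed
    then have "\<exists>U. \<forall>\<^sub>F l in sequentially. g z = g w * exp (U l) \<and> norm (U l) \<le> 8 * r / \<rho> l * M"
      by (simp add: eventually_ex)
    then obtain U where U: "\<forall>\<^sub>F l in sequentially. g z = g w * exp (U l)"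
       "\<forall>\<^sub>F l in sequentially. norm (U l) \<le> 8 * r / \<rho> l * M"
      by (auto simp: eventually_conj_iff)
    have "(\<lambda>l. 8 * r / \<rho> l * M) \<longlonglongrightarrow> 0 * M"
      by (intro tendsto_intros tendsto_divide_0[OF tendsto_const] filterlim_at_top_imp_at_infinity ninf)
    then have "U \<longlonglongrightarrow> 0" using Lim_null_comparison[OF U(2)] by simp
    then have "(\<lambda>l. g w * exp (U l)) \<longlonglongrightarrow> g w * exp 0" by (intro tendsto_intros)
    moreover have "(\<lambda>l. g w * exp (U l)) \<longlonglongrightarrow> g z"
      using U(1) by (intro tendsto_eventually) (auto elim: eventually_mono)
    ultimately show ?thesis using LIMSEQ_unique by force
  qed
  \<comment> \<open>The case split provides a witness: if every point were bad, any value would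
    serve vacuously.\<close>
  obtain a where a: "\<And>z. z \<notin> bad g \<Longrightarrow> g z = a"
    using const by (cases "bad g = UNIV") (metis UNIV_I, metis UNIV_eq_I)
  have "\<forall>\<^sub>\<approx>z\<in>UNIV. g z = a"
    using bad_sparse a unfolding eventually_cosparse
    by (elim sparse_in_subset2) auto
  then show ?thesis by blast
qed

text \<open>Dividing the expansion of the k-th difference by g reduces it to quotients with the
  shifts q^j z + c_j. Since |q| < 1, the most expensive shift is j = k, which costs -k ln |q|. The
  common bound V for both outer radii lets T be factored out of the whole estimate.\<close>

lemma proximity_hahn_diff_le:
  assumes q: "0 < norm q" "norm q < 1"
    and a: "(hahn_diff q c ^^ k) g = (\<lambda>z. \<Sum>j\<le>k. a j z * g (((\<lambda>z. q * z + c) ^^ j) z))"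
      "\<And>z j. norm z = r \<Longrightarrow> j \<le> k \<Longrightarrow> norm (a j z) \<le> 1"
    and r: "norm q * r + norm c \<le> r" "good_radius g r"
      "\<And>j z. norm z = r \<Longrightarrow> ((\<lambda>z. q * z + c) ^^ j) z \<notin> bad g"
    and R: "good_radius g R" "good_radius g R'" "1 \<le> R" "2 * r \<le> R" "R < R'"
    and V: "2 * nev R + nev_const \<le> V" "2 * nev R' + nev_const \<le> V"
  shows "proximity r (\<lambda>z. (hahn_diff q c ^^ k) g z / g z) \<le> ln (real (Suc k)) +
    real (Suc k) * (V * (8 * r / R + (2 * ln (2 * R) - 2 * ln r - real k * ln (norm q)) / (ln R' - ln R)))"
proof -
  let ?f = "\<lambda>j z. ((\<lambda>z. q * z + c) ^^ j) z"
  let ?L = "2 * ln (2 * R) - 2 * ln r - real k * ln (norm q)"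
  let ?h = "\<lambda>j z. log_plus (norm (g (?f j z) / g z))"
  have r0: "r > 0" using good_pos[OF r(2)] .
  have lnq: "ln (norm q) < 0" using q by simp
  have lnR: "0 < ln R' - ln R" using R by simp
  have L0: "0 \<le> ?L"
  proof -
    have "ln r \<le> ln (2 * R)" using r0 R by (intro ln_mono) auto
    moreover have "real k * ln (norm q) \<le> 0" using lnq by (simp add: mult_nonneg_nonpos)
    ultimately show ?thesis by linarith
  qed
  have nb: "z \<notin> bad g" if "norm z = r" for z using good_not_bad[OF r(2) that] .
  have cont: "continuous_on (sphere 0 r) (?h j)" for j
  proof (intro continuous_on_log_plus continuous_on_divide)
    have img: "(\<lambda>z. q ^ j * z + ?f j 0) ` sphere 0 r \<inter> bad g = {}"
    proof -
      have "q ^ j * z + ?f j 0 \<notin> bad g" if "norm z = r" for z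
        using r(3)[OF that, of j] by (simp only: affine_iterate[of j q c z, symmetric] not_False_eq_True)
      then show ?thesis by auto
    qed
    have "continuous_on (sphere 0 r) (\<lambda>z. g (q ^ j * z + ?f j 0))"
      by (rule continuous_on_compose2[OF continuous_on_not_bad[OF img]]) (auto intro!: continuous_intros)
    moreover have eq: "(\<lambda>z. g (?f j z)) = (\<lambda>z. g (q ^ j * z + ?f j 0))"
      by (intro ext arg_cong[where f = g] affine_iterate)
    ultimately show "continuous_on (sphere 0 r) (\<lambda>z. g (?f j z))" by (subst eq)
    show "continuous_on (sphere 0 r) g" using nb by (intro continuous_on_not_bad) auto
  qed (use nb not_bad_nonzero in auto)
  have pj: "proximity r (\<lambda>z. g (?f j z) / g z) \<le> V * (8 * r / R + ?L / (ln R' - ln R))" if j: "j \<le> k" for j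
  proof -
    let ?S = "\<Sum>p\<in>bad g \<inter> ball 0 R. \<bar>real_of_int (zorder g p)\<bar>"
    have "proximity r (\<lambda>z. g (?f j z) / g z) = proximity r (\<lambda>z. g (q ^ j * z + ?f j 0) / g z)"
      by (intro arg_cong[where f = "proximity r"] ext arg_cong2[where f = "(/)"] arg_cong[where f = g]
          affine_iterate refl)
    also have "\<dots> \<le> 8 * r / R * (proximity R g + proximity R (\<lambda>z. 1 / g z)) +
       ?S * (2 * ln (2 * R) - ln (norm (q ^ j) * r) - ln r)"
    proof (rule proximity_shift_quotient[OF r(2) R(1) R(4)])
      show "norm (q ^ j) * r + norm (?f j 0) \<le> r"
        using norm_affine_iterate[OF r(1)] by (simp add: norm_power)
      show "q ^ j * z + ?f j 0 \<notin> bad g" if "norm z = r" for z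
        using r(3)[OF that, of j] by (simp only: affine_iterate[of j q c z, symmetric] not_False_eq_True)
    qed (use q in \<open>auto simp: norm_power power_le_one\<close>)
    also have "\<dots> \<le> 8 * r / R * V + (V / (ln R' - ln R)) * ?L"
    proof (intro add_mono mult_mono)
      show "proximity R g + proximity R (\<lambda>z. 1 / g z) \<le> V"
        using nev_bounds(2)[OF R(1,3)] V by linarith
      have "?S * (ln R' - ln R) \<le> V"
        using multiplicity_bound[OF R(2,3)] V R by linarith
      then show "?S \<le> V / (ln R' - ln R)" using lnR by (simp add: field_simps)
      have "0 \<le> ?S * (ln R' - ln R)" using lnR by (intro mult_nonneg_nonneg sum_nonneg) auto
      then have "0 \<le> V" using \<open>?S * (ln R' - ln R) \<le> V\<close> by (rule order_trans)
      then show "0 \<le> V / (ln R' - ln R)" using lnR by simp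
      have "ln (norm (q ^ j) * r) = real j * ln (norm q) + ln r"
        using q r0 by (simp add: ln_mult norm_power ln_realpow)
      moreover have "real k * ln (norm q) \<le> real j * ln (norm q)"
        using j lnq by (intro mult_right_mono_neg) auto
      ultimately show "2 * ln (2 * R) - ln (norm (q ^ j) * r) - ln r \<le> ?L" by linarith
      have "ln (norm (q ^ j) * r) \<le> ln (2 * R)"
      proof (rule ln_mono)
        have "norm q ^ j * r \<le> 1 * r" using q r0 by (intro mult_right_mono power_le_one) auto
        then show "norm (q ^ j) * r \<le> 2 * R" unfolding norm_power mult_1 using R r0 by linarith
        show "0 < norm (q ^ j) * r" using q r0 by simp
      qed
      moreover have "ln r \<le> ln (2 * R)" using r0 R by (intro ln_mono) auto
      ultimately show "0 \<le> 2 * ln (2 * R) - ln (norm (q ^ j) * r) - ln r" by linarith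
    qed (use r0 R in \<open>auto intro!: add_nonneg_nonneg proximity_nonneg\<close>)
    also have "\<dots> = V * (8 * r / R + ?L / (ln R' - ln R))"
      by (simp only: distrib_left times_divide_eq_left times_divide_eq_right mult.commute[of V])
    finally show ?thesis .
  qed
  have "proximity r (\<lambda>z. (hahn_diff q c ^^ k) g z / g z) \<le> circle_mean r (\<lambda>z. ln (real (Suc k)) + (\<Sum>j\<le>k. ?h j z))"
  proof (rule proximity_le_circle_mean)
    fix z :: complex assume z: "norm z = r"
    have "norm ((hahn_diff q c ^^ k) g z / g z) = norm (\<Sum>j\<le>k. a j z * (g (?f j z) / g z))"
      by (simp add: a(1) sum_divide_distrib)
    also have "\<dots> \<le> (\<Sum>j\<le>k. norm (g (?f j z) / g z))"
    proof (rule sum_norm_le)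
      fix j assume "j \<in> {..k}"
      then have "norm (a j z) * norm (g (?f j z) / g z) \<le> 1 * norm (g (?f j z) / g z)"
        using a(2)[OF z, of j] by (intro mult_right_mono) auto
      then show "norm (a j z * (g (?f j z) / g z)) \<le> norm (g (?f j z) / g z)" by (simp only: norm_mult mult_1)
    qed
    finally have "log_plus (norm ((hahn_diff q c ^^ k) g z / g z)) \<le> log_plus (\<Sum>j\<le>k. norm (g (?f j z) / g z))"
      by (rule log_plus_mono)
    also have "\<dots> \<le> ln (real (Suc k)) + (\<Sum>j\<le>k. ?h j z)" by (rule log_plus_sum_le) simp
    finally show "log_plus (norm ((hahn_diff q c ^^ k) g z / g z)) \<le> ln (real (Suc k)) + (\<Sum>j\<le>k. ?h j z)" .
  qed (use r0 cont in \<open>auto intro!: continuous_intros\<close>)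
  also have "\<dots> = ln (real (Suc k)) + (\<Sum>j\<le>k. circle_mean r (?h j))"
    using r0 by (intro circle_mean_const_plus_sum cont) auto
  also have "\<dots> \<le> ln (real (Suc k)) + (\<Sum>j\<le>k. V * (8 * r / R + ?L / (ln R' - ln R)))"
    using pj unfolding proximity_eq_circle_mean by (intro add_left_mono sum_mono) auto
  finally show ?thesis by simp
qed

end

text \<open>\<open>nev_quasi_mono\<close> loses a factor 3, whereas
  \<open>sparse_doubling_indices\<close> needs a monotone sequence; passing to running maxima
  restores monotonicity and keeps the growth o(j), since finitely many early terms contribute only a
  constant.\<close>

lemma running_max_sublinear:
  fixes v :: "nat \<Rightarrow> real"
  assumes v0: "\<And>i. 0 \<le> v i" and lim: "(\<lambda>i. v i / real i) \<longlonglongrightarrow> 0"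
  shows "(\<lambda>j. Max (v ` {..j}) / real j) \<longlonglongrightarrow> 0"
proof (rule LIMSEQ_I)
  fix e :: real assume e: "0 < e"
  obtain N where N: "\<And>i. i \<ge> N \<Longrightarrow> v i / real i < e / 2"
    using order_tendstoD(2)[OF lim, of "e / 2"] e by (auto simp: eventually_sequentially)
  define A where "A = Max (v ` {..N})"
  have A: "v i \<le> A" if "i \<le> N" for i unfolding A_def using that by (intro Max_ge) auto
  obtain M :: nat where M: "2 * A / e < real M" using reals_Archimedean2 by blast
  show "\<exists>no. \<forall>j\<ge>no. norm (Max (v ` {..j}) / real j - 0) < e"
  proof (intro exI allI impI)
    fix j assume j: "N + M + 1 \<le> j"
    have "v i < e * real j" if "i \<le> j" for i
    proof (cases "i \<le> N")
      case True
      have "2 * A / e < real j" using M j by linarith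
      then have "2 * A < e * real j" using e by (simp add: field_simps)
      moreover have "0 \<le> A" using v0[of 0] A[of 0] by linarith
      ultimately show ?thesis using A[OF True] by linarith
    next
      case False
      then have "v i < e / 2 * real i" using N[of i] by (simp add: field_simps)
      also have "\<dots> \<le> e * real j" using that e by (intro mult_mono) auto
      finally show ?thesis .
    qed
    then have "Max (v ` {..j}) < e * real j" by (subst Max_less_iff) auto
    moreover have "0 \<le> Max (v ` {..j})" using v0[of 0] by (subst Max_ge_iff) auto
    ultimately show "norm (Max (v ` {..j}) / real j - 0) < e" using j by (simp add: field_simps)
  qed
qed

lemma le_exp_log_plus: "x \<le> exp (log_plus x)"
  by (simp add: log_plus_def)

section \<open>Choice of the radii, the exceptional set and the final estimate\<close>

context nonzero_meromorphic
begin

lemma log_nev_sublinear: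
  assumes order: "growth_order g = 0"
    and good: "\<And>i. good_radius g (\<rho> i)"
    and rho: "\<And>i. exp (real i) < \<rho> i" "\<And>i. \<rho> i < exp (real i + 1) / 2"
  shows "(\<lambda>i. log_plus (nev (\<rho> i)) / real i) \<longlonglongrightarrow> 0"
proof (rule LIMSEQ_I)
  fix e :: real assume e: "0 < e"
  \<comment> \<open>A third of e leaves room for ln \<rho> i <= i + 1 <= 2 i.\<close>
  have "Limsup at_top (\<lambda>r. ereal (log_plus (characteristic r g) / ln r)) < ereal (e / 3)"
    using order e by (simp add: growth_order_def)
  then have "\<forall>\<^sub>F r in at_top. ereal (log_plus (characteristic r g) / ln r) < ereal (e / 3)"
    by (rule Limsup_lessD)
  then obtain X where X: "\<And>r. r \<ge> X \<Longrightarrow> log_plus (characteristic r g) / ln r < e / 3"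
    by (auto simp: eventually_at_top_linorder)
  obtain N :: nat where N: "X < real N" using reals_Archimedean2 by blast
  show "\<exists>no. \<forall>i\<ge>no. norm (log_plus (nev (\<rho> i)) / real i - 0) < e"
  proof (intro exI allI impI)
    fix i assume i: "N + 1 \<le> i"
    have "real i \<le> exp (real i)" using exp_ge_add_one_self[of "real i"] by linarith
    then have rX: "X \<le> \<rho> i" "0 < \<rho> i" "1 < \<rho> i" using rho(1)[of i] N i by linarith+
    have "\<rho> i < exp (real i + 1)" using rho(2)[of i] rX by linarith
    then have "ln (\<rho> i) \<le> ln (exp (real i + 1))" using rX by (intro ln_mono) auto
    then have lr: "ln (\<rho> i) \<le> real i + 1" by simp
    have lpos: "0 < ln (\<rho> i)" using rX by simp
    have "log_plus (nev (\<rho> i)) < e / 3 * ln (\<rho> i)"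
      using X[OF rX(1)] lpos by (simp add: characteristic_eq_nev[OF good] field_simps)
    also have "\<dots> \<le> e / 3 * (2 * real i)" using lr e i by (intro mult_left_mono) auto
    also have "\<dots> < e * real i" using e i by simp
    finally show "norm (log_plus (nev (\<rho> i)) / real i - 0) < e" using i by (simp add: field_simps)
  qed
qed

text \<open>The set E is constructed before k is fixed, so one set serves the first and the k-th
  difference at once.\<close>

lemma hahn_diff_quotient_smallo:
  assumes q: "0 < norm q" "norm q < 1"
    and nonconst: "\<not> (\<exists>a. \<forall>\<^sub>\<approx>z\<in>UNIV. g z = a)" and order: "growth_order g = 0"
  shows "\<exists>E. has_log_density_one E \<and>
    (\<forall>k. (\<lambda>r. proximity r (\<lambda>z. (hahn_diff q c ^^ k) g z / g z))
       \<in> o[inf at_top (principal E)](\<lambda>r. characteristic r g))"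
proof -
  let ?f = "\<lambda>j z. ((\<lambda>z. q * z + c) ^^ j) z"
  \<comment> \<open>Radii of circles meeting an iterated preimage of a bad point; j = 0 gives the
    circles through the bad points themselves.\<close>
  define C where "C = (\<Union>j. norm ` {z. ?f j z \<in> bad g})"
  have q0: "q \<noteq> 0" using q by auto
  have "countable {z. ?f j z \<in> bad g}" for j
  proof (rule countable_image_inj_on)
    show "inj_on (?f j) {z. ?f j z \<in> bad g}"
    proof (rule inj_onI)
      fix x y assume "?f j x = ?f j y"
      then have "q ^ j * x = q ^ j * y"
        using affine_iterate[of j q c x] affine_iterate[of j q c y] by (metis add_right_cancel)
      then show "x = y" using q0 by simp
    qed
    show "countable (?f j ` {z. ?f j z \<in> bad g})"
      by (rule countable_subset[OF _ countable_bad]) auto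
  qed
  then have C: "countable C" unfolding C_def by blast
  have img: "?f j z \<notin> bad g" if "norm z \<notin> C" for j z using that unfolding C_def by blast
  have goodC: "good_radius g r" if "0 < r" "r \<notin> C" for r
    using img[of _ 0] that by (auto simp: good_radius_def)
  have e2: "2 < exp (1::real)"
    using exp_lower_Taylor_quadratic[of 1] by simp
  have "\<exists>x. exp (real i) < x \<and> x < exp (real i + 1) / 2 \<and> x \<notin> C" for i
  proof -
    \<comment> \<open>The interval is nonempty because e > 2. Halving its upper end yields 2 \<rho>
      i < e^(i+1), the room that \<open>nev_quasi_mono\<close> asks for.\<close>
    have "exp (real i) < exp (real i + 1) / 2" using e2 by (simp add: exp_add)
    then have "uncountable ({exp (real i)<..<exp (real i + 1) / 2} - C)"
      using uncountable_minus_countable[OF _ C] uncountable_open_interval by blast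
    then have "{exp (real i)<..<exp (real i + 1) / 2} - C \<noteq> {}" by (metis countable_empty)
    then show ?thesis by auto
  qed
  then obtain \<rho> where rho: "\<And>i. exp (real i) < \<rho> i" "\<And>i. \<rho> i < exp (real i + 1) / 2" "\<And>i. \<rho> i \<notin> C"
    by metis
  have rho1: "1 < \<rho> i" for i using rho(1)[of i] one_le_exp_iff[of "real i"] by linarith
  have good: "good_radius g (\<rho> i)" for i using goodC rho1[of i] rho(3) by auto
  have rhoU: "\<rho> i < exp (real i + 1)" for i using rho(2)[of i] rho1[of i] by linarith
  define u where "u = (\<lambda>j. Max ((\<lambda>i. log_plus (nev (\<rho> i))) ` {..j}))"
  have v_le_u: "log_plus (nev (\<rho> i)) \<le> u j" if "i \<le> j" for i j
    unfolding u_def using that by (intro Max_ge) auto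
  have u_mono: "mono u" unfolding u_def by (intro monoI Max_mono) auto
  have u_nonneg: "0 \<le> u j" for j using v_le_u[of j j] order_trans[OF log_plus_nonneg] by blast
  have u_lim: "(\<lambda>j. u j / real j) \<longlonglongrightarrow> 0"
    unfolding u_def by (intro running_max_sublinear log_nev_sublinear order good rho) auto
  \<comment> \<open>As u is the logarithm of a characteristic, ln 2 stands for doubling.\<close>
  obtain G where G: "(\<lambda>m. card (G \<inter> {..<m}) / real m) \<longlonglongrightarrow> 1"
    "\<And>n. \<forall>\<^sub>F j in sequentially. j \<in> G \<longrightarrow> j \<notin> {j. u (j + n) > u j + ln 2}"
  proof (rule density_zero_diagonal[of "\<lambda>n. {j. u (j + n) > u j + ln 2}"])
    fix i n :: nat assume "i \<le> n"
    then have "u (j + i) \<le> u (j + n)" for j using u_mono by (simp add: mono_def)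
    then show "{j. u (j + i) > u j + ln 2} \<subseteq> {j. u (j + n) > u j + ln 2}"
      by (blast intro: less_le_trans)
  next
    show "(\<lambda>m. card ({j. u (j + n) > u j + ln 2} \<inter> {..<m}) / real m) \<longlonglongrightarrow> 0" for n
      by (intro sparse_doubling_indices u_mono u_nonneg u_lim) simp
  qed blast
  \<comment> \<open>The interval with index j starts at e^(j+1), above 2 \<rho> i for all i <= j, so
    that \<open>nev\<close> at these radii is at most 3 times \<open>nev r\<close>.\<close>
  define E where "E = (\<Union>j\<in>G. {exp (real j + 1)..<exp (real j + 2)}) - C"
  have "(\<lambda>r. proximity r (\<lambda>z. (hahn_diff q c ^^ k) g z / g z))
       \<in> o[inf at_top (principal E)](\<lambda>r. characteristic r g)" for k
  proof (rule landau_o.smallI)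
    fix \<epsilon> :: real assume eps: "0 < \<epsilon>"
    obtain a X where aX: "\<forall>z. (\<forall>g. (hahn_diff q c ^^ k) g z = (\<Sum>j\<le>k. a j z * g (?f j z))) \<and>
        (X \<le> norm z \<longrightarrow> (\<forall>j\<le>k. norm (a j z) \<le> 1))"
      using hahn_diff_iterate[OF q, of k c] by blast
    have a: "(hahn_diff q c ^^ k) g = (\<lambda>z. \<Sum>j\<le>k. a j z * g (?f j z))" using aX by blast
    define D where "D = - real k * ln (norm q)"
    have D0: "0 \<le> D" using q by (simp add: D_def mult_nonneg_nonpos)
    let ?K = "real (Suc k)"
    \<comment> \<open>Bound for the bracket in \<open>proximity_hahn_diff_le\<close> when R = \<rho>
      (j + n) and R' = \<rho> (j + s).\<close>
    let ?br = "\<lambda>n::nat. 8 * exp (2 - real n) + (2 * real n + D) / real n ^ 2"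
    \<comment> \<open>13 = 2 * 6 + 1: at R and R' the value of \<open>nev\<close> is at most 2 * 3
      times \<open>nev r\<close>, by non-doubling and quasi-monotonicity, and
      \<open>nev_const\<close> is at most \<open>nev r\<close>.\<close>
    have "(\<lambda>n. 13 * ?K * ?br n) \<longlonglongrightarrow> 0" by real_asymp
    then have "\<forall>\<^sub>F n in sequentially. 13 * ?K * ?br n < \<epsilon> / 2"
      by (rule order_tendstoD(2)) (use eps in simp)
    then have "\<exists>n. 3 \<le> n \<and> 13 * ?K * ?br n < \<epsilon> / 2"
      by (intro eventually_happens'[OF sequentially_bot] eventually_conj eventually_ge_at_top)
    then obtain n where n: "3 \<le> n" "13 * ?K * ?br n < \<epsilon> / 2" by (elim exE conjE)
    \<comment> \<open>Since ln R' >= j + s and ln R <= j + n + 1, this makes ln (R'/R) at least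
      n^2.\<close>
    define s where "s = n + 1 + n^2"
    \<comment> \<open>The threshold makes \<open>nev r\<close> exceed \<open>nev_const\<close> and
      confines ln (k + 1) to half of \<epsilon> times \<open>nev r\<close>; its factor 3 is lost in
      passing from \<rho> i0 to r.\<close>
    have "\<exists>i. nev (\<rho> i) > 3 * (1 + nev_const + 2 / \<epsilon> * ln ?K)"
      using nev_bounded_imp_constant[OF good rho(1)] nonconst by (meson not_less)
    then obtain i0 where i0: "nev (\<rho> i0) > 3 * (1 + nev_const + 2 / \<epsilon> * ln ?K)" by blast
    obtain J where J: "\<And>j. j \<ge> J \<Longrightarrow> j \<in> G \<Longrightarrow> u (j + s) \<le> u j + ln 2"
      using G(2)[of s] by (auto simp: eventually_sequentially not_less)
    \<comment> \<open>Beyond r0 the index j of r exceeds J and i0, the coefficients have modulus at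
      most 1, and z -> q z + c maps |z| <= r into itself.\<close>
    define r0 where "r0 = max (exp (real (max J i0) + 2)) (max X (norm c / (1 - norm q)))"
    have main: "proximity r (\<lambda>z. (hahn_diff q c ^^ k) g z / g z) \<le> \<epsilon> * nev r \<and> 0 \<le> nev r \<and> good_radius g r"
      if r: "r0 \<le> r" "r \<in> E" for r
    proof -
      obtain j where j: "j \<in> G" "exp (real j + 1) \<le> r" "r < exp (real j + 2)"
        and rC: "r \<notin> C" using r by (auto simp: E_def)
      have r1: "1 < r" using j(2) one_less_exp_iff[of "real j + 1"] by linarith
      have gr: "good_radius g r" using goodC r1 rC by auto
      have "exp (real (max J i0) + 2) \<le> r" using r by (simp add: r0_def)
      then have "exp (real (max J i0) + 2) < exp (real j + 2)" using j(3) by linarith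
      then have jJ: "J \<le> j" "i0 \<le> j" by auto
      have rX: "X \<le> r" and rc: "norm c / (1 - norm q) \<le> r" using r by (auto simp: r0_def)
      have qr: "norm q * r + norm c \<le> r" using rc q by (simp add: field_simps)
      have nev_le: "nev (\<rho> i) \<le> 3 * nev r" if "i \<le> j" for i
      proof (rule nev_quasi_mono[OF good gr])
        have "exp (real i + 1) \<le> exp (real j + 1)" using that by simp
        then show "2 * \<rho> i \<le> r" using rho(2)[of i] j(2) by linarith
      qed (use r1 in auto)
      have nc: "0 \<le> nev_const" by (simp add: nev_const_def)
      have lnK: "0 \<le> 2 / \<epsilon> * ln ?K" using eps by simp
      have "3 * (1 + nev_const + 2 / \<epsilon> * ln ?K) \<le> 3 * nev r"
        using less_imp_le[OF i0] nev_le[OF jJ(2)] by (rule order_trans)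
      then have nr: "1 + nev_const + 2 / \<epsilon> * ln ?K \<le> nev r"
        by (simp only: mult_le_cancel_left_pos zero_less_numeral)
      then have nr1: "1 \<le> nev r" "nev_const \<le> nev r" "2 / \<epsilon> * ln ?K \<le> nev r"
        using nc lnK by linarith+
      then have lnK': "ln ?K \<le> \<epsilon> / 2 * nev r" using eps by (simp add: field_simps)
      have "exp (u j) \<le> 3 * nev r"
      proof -
        have "u j \<in> (\<lambda>i. log_plus (nev (\<rho> i))) ` {..j}" unfolding u_def by (intro Max_in) auto
        then obtain i where i: "i \<le> j" "u j = log_plus (nev (\<rho> i))" by auto
        have "exp (u j) = max 1 (nev (\<rho> i))" by (simp add: i(2) log_plus_def)
        also have "\<dots> \<le> 3 * nev r" using nev_le[OF i(1)] nr1 by simp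
        finally show ?thesis .
      qed
      moreover have "exp (u (j + s)) \<le> exp (u j + ln 2)" using J[OF jJ(1) j(1)] by simp
      ultimately have us: "exp (u (j + s)) \<le> 6 * nev r" by (simp add: exp_add)
      have nev6: "nev (\<rho> (j + i)) \<le> 6 * nev r" if "i \<le> s" for i
      proof -
        have "nev (\<rho> (j + i)) \<le> exp (log_plus (nev (\<rho> (j + i))))" by (rule le_exp_log_plus)
        also have "\<dots> \<le> exp (u (j + s))" using v_le_u[of "j + i" "j + s"] that by simp
        finally show ?thesis using us by linarith
      qed
      let ?R = "\<rho> (j + n)" and ?R' = "\<rho> (j + s)"
      have ns: "n \<le> s" "n + 1 \<le> s" by (auto simp: s_def)
      \<comment> \<open>Here n >= 3 enters: 2 r < e^(j+3) <= e^(j+n) < R.\<close>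
      have "exp (real j + 2) * 2 \<le> exp (real j + 2) * exp 1" using e2 by (intro mult_left_mono) auto
      also have "\<dots> = exp (real j + 3)" by (simp add: exp_add[symmetric])
      also have "\<dots> \<le> exp (real (j + n))" using n by simp
      finally have rR: "2 * r \<le> ?R" using j(3) rho(1)[of "j + n"] by linarith
      have "exp (real (j + n) + 1) \<le> exp (real (j + s))" using ns by simp
      then have RR: "?R < ?R'" using rhoU[of "j + n"] rho(1)[of "j + s"] by linarith
      have Rpos: "0 < ?R" "0 < ?R'" using rho1[of "j + n"] rho1[of "j + s"] by linarith+
      have lnR': "real (j + s) \<le> ln ?R'"
        using rho(1)[of "j + s"] Rpos by (intro ln_ge_iff[THEN iffD2]) auto
      have ln2R: "ln (2 * ?R) \<le> real (j + n) + 1"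
      proof -
        have "ln (2 * ?R) \<le> ln (exp (real (j + n) + 1))"
          using rho(2)[of "j + n"] Rpos by (intro ln_mono) auto
        then show ?thesis by simp
      qed
      have lnR: "ln ?R \<le> ln (2 * ?R)" using Rpos by (intro ln_mono) auto
      have lnr: "real j + 1 \<le> ln r" using j(2) r1 by (intro ln_ge_iff[THEN iffD2]) auto
      have d1: "real n ^ 2 \<le> ln ?R' - ln ?R"
        using lnR' lnR ln2R by (simp add: s_def)
      have d2: "2 * ln (2 * ?R) - 2 * ln r - real k * ln (norm q) \<le> 2 * real n + D"
        using ln2R lnr by (simp add: D_def)
      have d3: "8 * r / ?R \<le> 8 * exp (2 - real n)"
      proof -
        have "r / ?R \<le> exp (real j + 2) / exp (real (j + n))"
          using j(3) rho(1)[of "j + n"] r1 by (intro frac_le) auto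
        also have "\<dots> = exp (2 - real n)" by (simp add: exp_diff[symmetric])
        finally show ?thesis by simp
      qed
      have d4: "8 * r / ?R + (2 * ln (2 * ?R) - 2 * ln r - real k * ln (norm q)) / (ln ?R' - ln ?R) \<le> ?br n"
        using n D0 by (intro add_mono d3 frac_le d1 d2) auto
      have "proximity r (\<lambda>z. (hahn_diff q c ^^ k) g z / g z) \<le> ln ?K + ?K * (13 * nev r *
        (8 * r / ?R + (2 * ln (2 * ?R) - 2 * ln r - real k * ln (norm q)) / (ln ?R' - ln ?R)))"
      proof (rule proximity_hahn_diff_le[OF q a _ qr gr _ good good _ rR RR])
        show "norm (a i z) \<le> 1" if "norm z = r" "i \<le> k" for z i using aX rX that by blast
        show "?f i z \<notin> bad g" if "norm z = r" for i z using img rC that by blast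
        show "1 \<le> ?R" using rho1[of "j + n"] by simp
        show "2 * nev ?R + nev_const \<le> 13 * nev r" using nev6[OF ns(1)] nr1 by linarith
        show "2 * nev ?R' + nev_const \<le> 13 * nev r" using nev6[of s] nr1 by linarith
      qed
      also have "\<dots> \<le> ln ?K + ?K * (13 * nev r * ?br n)"
        using d4 nr1 by (intro add_left_mono mult_left_mono) auto
      also have "?K * (13 * nev r * ?br n) = 13 * ?K * ?br n * nev r" by (simp only: mult_ac)
      also have "ln ?K + 13 * ?K * ?br n * nev r \<le> \<epsilon> / 2 * nev r + \<epsilon> / 2 * nev r"
        using lnK' n(2) nr1 by (intro add_mono mult_right_mono) auto
      also have "\<dots> = \<epsilon> * nev r" by simp
      finally show ?thesis using gr nr1 by simp
    qed
    show "\<forall>\<^sub>F r in inf at_top (principal E). norm (proximity r (\<lambda>z. (hahn_diff q c ^^ k) g z / g z))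
        \<le> \<epsilon> * norm (characteristic r g)"
      unfolding eventually_inf_principal using eventually_ge_at_top[of r0]
    proof eventually_elim
      case (elim r)
      show ?case
      proof
        assume "r \<in> E"
        then have m: "proximity r (\<lambda>z. (hahn_diff q c ^^ k) g z / g z) \<le> \<epsilon> * nev r" "0 \<le> nev r" "good_radius g r"
          using main[OF elim] by auto
        have "0 \<le> proximity r (\<lambda>z. (hahn_diff q c ^^ k) g z / g z)"
          using good_pos[OF m(3)] by (intro proximity_nonneg) auto
        then show "norm (proximity r (\<lambda>z. (hahn_diff q c ^^ k) g z / g z)) \<le> \<epsilon> * norm (characteristic r g)"
          using m by (simp add: characteristic_eq_nev)
      qed
    qed
  qed
  moreover have "has_log_density_one E" unfolding E_def by (rule has_log_density_one_intervals[OF G(1) C])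
  ultimately show ?thesis by blast
qed

end

theorem theorem1:
  fixes q c :: complex and k :: nat and g :: "complex \<Rightarrow> complex"
  assumes "0 < norm q" and "norm q < 1"
    and "k \<ge> 1"
    and "g meromorphic_on UNIV"
    and "\<not> (\<exists>a. \<forall>\<^sub>\<approx>z\<in>UNIV. g z = a)"
    and "growth_order g = 0"
  shows "\<exists>E. has_log_density_one E \<and>
    (\<lambda>r. proximity r (\<lambda>z. hahn_diff q c g z / g z))
       \<in> o[inf at_top (principal E)](\<lambda>r. characteristic r g) \<and>
    (\<lambda>r. proximity r (\<lambda>z. (hahn_diff q c ^^ k) g z / g z))
       \<in> o[inf at_top (principal E)](\<lambda>r. characteristic r g)"
proof -
  interpret nonzero_meromorphic g
    using assms(4,5) by unfold_locales auto
  obtain E where E: "has_log_density_one E"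
    "\<And>k. (\<lambda>r. proximity r (\<lambda>z. (hahn_diff q c ^^ k) g z / g z))
       \<in> o[inf at_top (principal E)](\<lambda>r. characteristic r g)"
    using hahn_diff_quotient_smallo[OF assms(1,2,5,6)] by blast
  have "(\<lambda>r. proximity r (\<lambda>z. hahn_diff q c g z / g z))
       \<in> o[inf at_top (principal E)](\<lambda>r. characteristic r g)"
    using E(2)[of 1] by simp
  then show ?thesis using E by blast
qed

end
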